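(* Let $\varepsilon_0 = (e-1)(1-\log(e-1))$ and $S_{\varepsilon_0} = \{(r,s) \in \mathbb{N}\times\mathbb{N} : \varepsilon_0 \le s/r \le 1/\varepsilon_0\}$. Let $f:\mathbb{R}^+\to\mathbb{R}^+$, $f(t) = \frac{(1-e^t)\log(1-e^{-t})}{t}$ (this is a bijection). For $(r,s) \in S_{\varepsilon_0}$ put $x = x(r,s) = f^{-1}(s/r)$ and $y = y(r,s) = f^{-1}(r/s)$, and let $$Q(x,y) = xy e^{-x-y}\left[ y e^{-y} + x e^{-x} - xy(e^{-y}+e^{-x})\right].$$ Then, uniformly as $r,s \to \infty$ with $(r,s) \in S_{\varepsilon_0}$, $$[b^{r-1}a^s] = s!\, r! \left(e^{-y} + O(s^{-1/2})\right) \frac{1}{\sqrt{2\pi}} x^{-r} y^{-s} \sqrt{\frac{y e^{-y}}{s\,Q(x,y)}},$$ where the implied constant in $O(s^{-1/2})$ is uniform over $S_{\varepsilon_0}$.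
   Context: For $n\ge1$, $S_n$ is the set of permutations of $[n]$. For non-negative integers $p+q=n-1$, $[b^p a^q]$ denotes the number of permutations $\pi \in S_n$ such that, for $i \in [n-1]$, $\pi(i) > i$ holds if and only if $i \in \{1,\dots,p\}$. Here $\mathbb{N}$ denotes the positive integers (so $r\ge 1$ and $[b^{r-1}a^s]$ concerns permutations of $[r+s]$). *)

theory Defs
  imports "HOL-Analysis.Analysis" "HOL-Combinatorics.Permutations"
begin

definition ba_count :: "nat \<Rightarrow> nat \<Rightarrow> nat" where
  "ba_count p q = card {\<pi>. \<pi> permutes {1..p+q+1} \<and>
      (\<forall>i\<in>{1..p+q}. (\<pi> i > i \<longleftrightarrow> i \<in> {1..p}))}"

definition eps0 :: real where
  "eps0 = (exp 1 - 1) * (1 - ln (exp 1 - 1))"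

definition S_eps0 :: "(nat \<times> nat) set" where
  "S_eps0 = {(r, s). r \<ge> 1 \<and> s \<ge> 1 \<and> eps0 \<le> real s / real r \<and> real s / real r \<le> 1 / eps0}"

definition fpm :: "real \<Rightarrow> real" where
  "fpm t = (1 - exp t) * ln (1 - exp (- t)) / t"

definition fpm_inv :: "real \<Rightarrow> real" where
  "fpm_inv v = (THE t. t > 0 \<and> fpm t = v)"

definition Qxy :: "real \<Rightarrow> real \<Rightarrow> real" where
  "Qxy x y = x * y * exp (- x - y) *
     (y * exp (- y) + x * exp (- x) - x * y * (exp (- y) + exp (- x)))"

end

theory Submission
  imports Defs "HOL-Probability.Probability"
begin

text \<open>
  Inclusion--exclusion over the prescribed excedances shows that $[b^{r-1}a^s]/(r!\,s!)$ is the
  coefficient of $x^r y^s$ in $e^x / (1 - (e^x-1)(e^y-1)) = \sum_j e^x (e^x-1)^j (e^y-1)^j$.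
  If $(e^x-1)(e^y-1)=1$, equivalently $e^{-x}+e^{-y}=1$, then after multiplication by $x^r y^s$
  the $j$-th summand is $e^x$ times the product of two independent point probabilities: that a sum
  of $j$ zero-truncated Poisson variables with parameter $x$, plus a Poisson variable, equals $r$,
  and that a sum of $j$ zero-truncated Poisson variables with parameter $y$ equals $s$. The
  equation $f(x) = s/r$ says that $(r,s)$ is a multiple $n$ of the mean vector. A local limit
  theorem with error $O(1/j)$, uniform in the parameters, turns the sum over $j$ into a
  Gaussian sum concentrated at $j = n$, which is a Riemann sum for a Gaussian integral; the total
  error is $O(1/n)$ against a main term of order $n^{-1/2}$. On $S_{\varepsilon_0}$ both
  parameters lie in $[1/3, 1]$.
\<close>

section \<open>Permutations with a prescribed excedance set\<close>

text \<open>Precision O(1/j) in the local limit theorem is what the error budget asks for. Among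
  O(n) indices j comparable to n, the product of two such errors sums to n * n^(-2), and an error
  times a Gaussian of height n^(-1/2) and width n^(1/2) sums to n^(-1). For j much smaller than n
  the error C/j says nothing useful; there the probability attached to y is exponentially small by
  an estimate on a larger circle, while every j > r contributes exactly 0 because e^x - 1 has no
  constant term.

  The two parameters are tied together: if e^(-x) + e^(-y) = 1, then f(x) is the ratio of the two
  means, hence f(x) f(y) = 1 and y is the parameter belonging to r/s. Moreover f(1) equals
  \<open>eps0\<close>, so the region of the theorem amounts to x \<le> 1 and y \<le> 1. This
  confines means and variances to fixed intervals away from 0, which makes all constants
  absolute.\<close>

text \<open>
  Used with $K < P < Q$ elementwise. Writing ``excedance at $\min P$'' as ``no constraint'' minus
  ``no excedance'' there gives a recurrence in the three cardinalities alone.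
\<close>

definition excount :: "nat set \<Rightarrow> nat set \<Rightarrow> nat set \<Rightarrow> nat" where
  "excount K P Q = card {\<pi>. \<pi> permutes (K \<union> P \<union> Q) \<and> (\<forall>i\<in>P. \<pi> i > i) \<and> (\<forall>i\<in>Q. \<pi> i \<le> i)}"

text \<open>
  Composing with the transposition of $\pi(m)$ and $m$ makes $m$ a fixed point without affecting
  the constraints at positions above $m$.
\<close>

lemma card_permutes_le_at:
  fixes m :: nat
  assumes fin: "finite U" and m: "m \<in> U"
    and P: "\<forall>i\<in>P. m < i" and Q: "\<forall>i\<in>Q. m < i"
  shows "card {\<pi>. \<pi> permutes U \<and> \<pi> m \<le> m \<and> (\<forall>i\<in>P. \<pi> i > i) \<and> (\<forall>i\<in>Q. \<pi> i \<le> i)} =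
    card {v\<in>U. v \<le> m} *
    card {\<pi>. \<pi> permutes (U - {m}) \<and> (\<forall>i\<in>P. \<pi> i > i) \<and> (\<forall>i\<in>Q. \<pi> i \<le> i)}"
    (is "card ?A = card ?L * card ?B")
proof -
  let ?f = "\<lambda>(v, \<sigma>). Transposition.transpose v m \<circ> \<sigma>"
  let ?g = "\<lambda>\<pi>. (\<pi> m, Transposition.transpose (\<pi> m) m \<circ> \<pi>)"
  have "bij_betw ?f (?L \<times> ?B) ?A"
  proof (rule bij_betw_byWitness[where f' = ?g])
    show "\<forall>a\<in>?L \<times> ?B. ?g (?f a) = a"
      by (auto simp: permutes_not_in fun_eq_iff)
    show "\<forall>a\<in>?A. ?f (?g a) = a"
      by (auto simp: fun_eq_iff)
    have "Transposition.transpose v m \<circ> \<sigma> \<in> ?A" if v: "v \<in> ?L" and s: "\<sigma> \<in> ?B" for v \<sigma>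
    proof -
      have s1: "\<sigma> permutes (U - {m})" and v1: "v \<in> U" "v \<le> m" using s v by auto
      have s': "\<sigma> permutes U" using s1 by (rule permutes_subset) auto
      have "Transposition.transpose v m \<circ> \<sigma> permutes U"
        by (rule permutes_compose[OF s' permutes_swap_id[OF v1(1) m]])
      moreover have "(Transposition.transpose v m \<circ> \<sigma>) m \<le> m"
        using v1 permutes_not_in[OF s1] by simp
      \<comment> \<open>For i in \<open>P\<close> the value \<sigma> i exceeds i > m \<ge> v, so the
        transposition leaves it alone. For i in \<open>Q\<close> only values at most m < i can be
        exchanged, so the constraint survives.\<close>
      moreover have "i < (Transposition.transpose v m \<circ> \<sigma>) i" if "i \<in> P" for i
      proof -
        have "m < i" "i < \<sigma> i" using that P s by auto
        then show ?thesis using v1 by (simp add: transpose_def)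
      qed
      moreover have "(Transposition.transpose v m \<circ> \<sigma>) i \<le> i" if "i \<in> Q" for i
      proof -
        have "m < i" "\<sigma> i \<le> i" using that Q s by auto
        then show ?thesis using v1 by (cases "\<sigma> i = v"; cases "\<sigma> i = m") auto
      qed
      ultimately show ?thesis by blast
    qed
    then show "?f ` (?L \<times> ?B) \<subseteq> ?A" by auto
    have "(\<pi> m, Transposition.transpose (\<pi> m) m \<circ> \<pi>) \<in> ?L \<times> ?B" if p: "\<pi> \<in> ?A" for \<pi>
    proof -
      have p1: "\<pi> permutes U" and le: "\<pi> m \<le> m" using p by auto
      have v: "\<pi> m \<in> U" using permutes_in_image[OF p1] m by simp
      let ?s = "Transposition.transpose (\<pi> m) m \<circ> \<pi>"
      have "?s permutes U"
        by (rule permutes_compose[OF p1 permutes_swap_id[OF v m]])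
      then have "?s permutes (U - {m})"
        by (rule permutes_superset) auto
      moreover have "i < ?s i" if "i \<in> P" for i
      proof -
        have "m < i" "i < \<pi> i" using that P p by auto
        then show ?thesis using le by (simp add: transpose_def)
      qed
      moreover have "?s i \<le> i" if "i \<in> Q" for i
      proof -
        have "m < i" "\<pi> i \<le> i" using that Q p by auto
        then show ?thesis using le by (cases "\<pi> i = \<pi> m"; cases "\<pi> i = m") auto
      qed
      ultimately show ?thesis using v le by simp
    qed
    then show "?g ` ?A \<subseteq> ?L \<times> ?B" by blast
  qed
  then have "card (?L \<times> ?B) = card ?A" by (rule bij_betw_same_card)
  then show ?thesis by (simp add: card_cartesian_product)
qed

text \<open>The values available at a non-excedance \<open>m\<close> are \<open>m\<close> itself and
  the elements of \<open>K\<close>, since \<open>P\<close> and \<open>Q\<close> lie above; hence the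
  factor \<open>card K + 1\<close>.\<close>

lemma excount_le_step:
  assumes fin: "finite K" "finite P" "finite Q"
    and ord: "\<forall>k\<in>K. k < m" "\<forall>i\<in>P. m < i" "\<forall>i\<in>Q. m < i"
  shows "card {\<pi>. \<pi> permutes (insert m (K \<union> P \<union> Q)) \<and> \<pi> m \<le> m \<and> (\<forall>i\<in>P. \<pi> i > i) \<and> (\<forall>i\<in>Q. \<pi> i \<le> i)}
    = (card K + 1) * excount K P Q"
proof -
  have L: "{v \<in> insert m (K \<union> P \<union> Q). v \<le> m} = insert m K" using ord by force
  have mm: "m \<notin> K" "m \<notin> P" "m \<notin> Q" using ord by auto
  then have U: "insert m (K \<union> P \<union> Q) - {m} = K \<union> P \<union> Q" by blast
  show ?thesis
    using card_permutes_le_at[of "insert m (K \<union> P \<union> Q)" m P Q] fin ord mm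
    unfolding L U excount_def by simp
qed

lemma excount_Q_step:
  assumes fin: "finite K" "finite Q" and ord: "\<forall>k\<in>K. k < m" "\<forall>i\<in>Q. m < i"
  shows "excount K {} (insert m Q) = (card K + 1) * excount K {} Q"
  using excount_le_step[of K "{}" Q m] fin ord by (simp add: excount_def)

lemma excount_P_step:
  assumes fin: "finite K" "finite P" "finite Q"
    and ord: "\<forall>k\<in>K. k < m" "\<forall>i\<in>P. m < i" "\<forall>i\<in>Q. m < i"
  shows "excount (insert m K) P Q = excount K (insert m P) Q + (card K + 1) * excount K P Q"
proof -
  let ?C = "\<lambda>\<pi>. \<pi> permutes (insert m (K \<union> P \<union> Q)) \<and> (\<forall>i\<in>P. \<pi> i > i) \<and> (\<forall>i\<in>Q. \<pi> i \<le> i)"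
  have fC: "finite {\<pi>. ?C \<pi>}"
    by (rule finite_subset[OF _ finite_permutations[of "insert m (K \<union> P \<union> Q)"]]) (use fin in auto)
  have "{\<pi>. ?C \<pi>} = {\<pi>. ?C \<pi> \<and> \<pi> m > m} \<union> {\<pi>. ?C \<pi> \<and> \<pi> m \<le> m}" by auto
  then have "card {\<pi>. ?C \<pi>} = card {\<pi>. ?C \<pi> \<and> \<pi> m > m} + card {\<pi>. ?C \<pi> \<and> \<pi> m \<le> m}"
    using fC by (subst card_Un_disjoint[symmetric]) auto
  moreover have "{\<pi>. ?C \<pi> \<and> \<pi> m > m} = {\<pi>. \<pi> permutes (K \<union> insert m P \<union> Q) \<and> (\<forall>i\<in>insert m P. \<pi> i > i) \<and> (\<forall>i\<in>Q. \<pi> i \<le> i)}"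
    by (auto simp: insert_commute)
  moreover have "{\<pi>. ?C \<pi> \<and> \<pi> m \<le> m} = {\<pi>. \<pi> permutes (insert m (K \<union> P \<union> Q)) \<and> \<pi> m \<le> m \<and> (\<forall>i\<in>P. \<pi> i > i) \<and> (\<forall>i\<in>Q. \<pi> i \<le> i)}"
    by auto
  ultimately show ?thesis
    using excount_le_step[OF assms] by (simp add: excount_def)
qed

text \<open>Deleting the least constrained position does not change \<open>K\<close>, so every
  element of \<open>Q\<close> contributes the same factor; the free permutations of \<open>K\<close>
  remain.\<close>

lemma excount_no_P:
  assumes "finite K" "finite Q" "\<forall>k\<in>K. \<forall>i\<in>Q. k < i"
  shows "excount K {} Q = fact (card K) * (card K + 1) ^ card Q"
  using assms(2,3)
proof (induction "card Q" arbitrary: Q)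
  case 0
  then show ?case using assms(1) card_permutations[OF refl assms(1)] by (simp add: excount_def)
next
  case (Suc q)
  define m where "m = Min Q"
  have ne: "Q \<noteq> {}" using Suc by auto
  have mQ: "m \<in> Q" unfolding m_def using Suc ne by auto
  have lt: "\<forall>i\<in>Q - {m}. m < i"
    using Suc.prems(1) by (auto simp: m_def order.strict_iff_order)
  have cQ: "card (Q - {m}) = q" using Suc.hyps(2) mQ Suc.prems(1) by simp
  have "excount K {} (Q - {m}) = fact (card K) * (card K + 1) ^ q"
    using Suc.hyps(1)[of "Q - {m}"] cQ Suc.prems by auto
  moreover have "excount K {} (insert m (Q - {m})) = (card K + 1) * excount K {} (Q - {m})"
    by (rule excount_Q_step) (use assms(1) Suc.prems lt mQ in auto)
  ultimately have "excount K {} Q = (card K + 1) * (fact (card K) * (card K + 1) ^ q)"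
    using mQ by (simp only: insert_Diff)
  then show ?case unfolding Suc.hyps(2)[symmetric] by (simp only: power_Suc mult_ac)
qed

section \<open>Solving the recurrence with exponential generating functions\<close>

abbreviation E1 :: "complex fps" where "E1 \<equiv> fps_exp 1"

text \<open>This is j! S(p+1, j+1) with S the Stirling numbers of the second kind;
  \<open>gam_coeff\<close> is the analogue with k distinguished elements. The type is complex
  because the coefficients are later extracted by Fourier integrals.\<close>

definition alpha_coeff :: "nat \<Rightarrow> nat \<Rightarrow> complex" where
  "alpha_coeff p j = fact p * fps_nth (E1 * (E1 - 1) ^ j) p"

definition gam_coeff :: "nat \<Rightarrow> nat \<Rightarrow> nat \<Rightarrow> complex" where
  "gam_coeff k j q = fact q * fps_nth (E1 ^ k * (E1 - 1) ^ j) q"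

text \<open>
  With $F = e^x/(1-(e^x-1)(e^y-1))$, these sums are the coefficients of $x^p y^q/(p!\,q!)$ in
  $k!\,(e^{y-x})^k F^{k+1}$; the recurrence in $p$ below is the differential equation of this
  family in $x$.
\<close>

definition Hsum :: "nat \<Rightarrow> nat \<Rightarrow> nat \<Rightarrow> complex" where
  "Hsum k p q = (\<Sum>j\<le>p. fact (j + k) / fact j * alpha_coeff p j * gam_coeff k j q)"

text \<open>The series e^x - 1 starts in degree 1. This makes the formally infinite sum over j
  finite and allows its upper limit to be moved freely beyond r.\<close>

lemma fps_exp_minus_one_power_nth_eq_0:
  assumes "p < j" shows "fps_nth (F * (E1 - 1) ^ j) p = 0"
proof -
  have "fps_nth ((E1 - 1) ^ j) i = 0" if "i < j" for i
    using startsby_zero_power_prefix[of "E1 - 1" j] that by simp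
  then show ?thesis using assms by (simp add: fps_mult_nth)
qed

lemma alpha_coeff_eq_0: "p < j \<Longrightarrow> alpha_coeff p j = 0"
  by (simp add: alpha_coeff_def fps_exp_minus_one_power_nth_eq_0)

lemma gam_coeff_Suc: "gam_coeff (Suc k) j q = gam_coeff k (Suc j) q + gam_coeff k j q"
proof -
  have "E1 ^ Suc k * (E1 - 1) ^ j = E1 ^ k * (E1 - 1) ^ Suc j + E1 ^ k * (E1 - 1) ^ j"
    by (simp add: algebra_simps)
  then show ?thesis by (simp add: gam_coeff_def algebra_simps)
qed

lemma gam_coeff_0: "gam_coeff k 0 q = of_nat k ^ q"
  by (simp add: gam_coeff_def fps_exp_power_mult)

text \<open>The Stirling recurrence, obtained by differentiating e^x (e^x - 1)^j and writing one
  factor e^x as (e^x - 1) + 1. At j = 0 the truncated \<open>j - 1\<close> is harmless because of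
  the factor \<open>of_nat j\<close>.\<close>

lemma alpha_coeff_Suc: "alpha_coeff (Suc p) j = of_nat j * alpha_coeff p (j - 1) + of_nat (j + 1) * alpha_coeff p j"
proof -
  have D: "fps_deriv (E1 * (E1 - 1) ^ j) =
      of_nat j * (E1 * (E1 - 1) ^ (j - 1)) + of_nat (j + 1) * (E1 * (E1 - 1) ^ j)"
  proof (cases j)
    case (Suc i)
    have "fps_deriv ((E1 - 1) ^ Suc i) = of_nat (Suc i) * E1 * (E1 - 1) ^ i"
      by (simp add: fps_deriv_power flip: fps_of_nat del: power_Suc of_nat_Suc)
    then show ?thesis unfolding Suc fps_deriv_mult by (simp add: algebra_simps)
  qed simp
  have "alpha_coeff (Suc p) j = fact p * fps_nth (fps_deriv (E1 * (E1 - 1) ^ j)) p"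
    by (simp only: alpha_coeff_def fps_deriv_nth fact_Suc mult_ac of_nat_mult Suc_eq_plus1[symmetric])
  also have "\<dots> = of_nat j * alpha_coeff p (j - 1) + of_nat (j + 1) * alpha_coeff p j"
    unfolding D alpha_coeff_def fps_add_nth fps_of_nat[symmetric] fps_mult_left_const_nth
    by (simp only: algebra_simps)
  finally show ?thesis .
qed

text \<open>The Stirling recurrence splits the sum in two. In one part the index is shifted, in the
  other j + 1 is written as (j + k + 1) - k; both times (j + k)! grows to (j + k + 1)!, and
  \<open>gam_coeff_Suc\<close> recombines the parts. With k = \<open>card K + 1\<close> this is the
  recurrence of \<open>excount_P_step\<close>.\<close>

lemma Hsum_Suc: "Hsum k (Suc p) q = Hsum (Suc k) p q - of_nat k * Hsum k p q"
proof -
  let ?c = "\<lambda>k j. fact (j + k) / fact j :: complex"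
  have "Hsum k (Suc p) q = (\<Sum>j\<le>Suc p. ?c k j * of_nat j * alpha_coeff p (j - 1) * gam_coeff k j q)
      + (\<Sum>j\<le>Suc p. ?c k j * of_nat (j + 1) * alpha_coeff p j * gam_coeff k j q)"
    unfolding Hsum_def alpha_coeff_Suc sum.distrib[symmetric]
    by (intro sum.cong) (auto simp: field_simps)
  also have "(\<Sum>j\<le>Suc p. ?c k j * of_nat j * alpha_coeff p (j - 1) * gam_coeff k j q)
      = (\<Sum>j\<le>p. ?c (Suc k) j * alpha_coeff p j * gam_coeff k (Suc j) q)"
  proof -
    have "?c k (Suc j) * of_nat (Suc j) = ?c (Suc k) j" for j
      by (simp add: field_simps del: of_nat_Suc)
    then show ?thesis by (subst sum.atMost_Suc_shift) (simp del: of_nat_Suc fact_Suc)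
  qed
  also have "(\<Sum>j\<le>Suc p. ?c k j * of_nat (j + 1) * alpha_coeff p j * gam_coeff k j q)
      = (\<Sum>j\<le>p. ?c k j * of_nat (j + 1) * alpha_coeff p j * gam_coeff k j q)"
    by (simp add: alpha_coeff_eq_0)
  also have "\<dots> = (\<Sum>j\<le>p. ?c (Suc k) j * alpha_coeff p j * gam_coeff k j q) - of_nat k * Hsum k p q"
    unfolding Hsum_def sum_distrib_left sum_subtractf[symmetric]
    by (intro sum.cong) (auto simp: algebra_simps add_divide_distrib diff_divide_distrib)
  finally have "Hsum k (Suc p) q = (\<Sum>j\<le>p. ?c (Suc k) j * alpha_coeff p j * gam_coeff k (Suc j) q)
      + ((\<Sum>j\<le>p. ?c (Suc k) j * alpha_coeff p j * gam_coeff k j q) - of_nat k * Hsum k p q)" .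
  moreover have "Hsum (Suc k) p q = (\<Sum>j\<le>p. ?c (Suc k) j * alpha_coeff p j * gam_coeff k (Suc j) q)
      + (\<Sum>j\<le>p. ?c (Suc k) j * alpha_coeff p j * gam_coeff k j q)"
    unfolding Hsum_def gam_coeff_Suc sum.distrib[symmetric] by (simp only: distrib_left)
  ultimately show ?thesis by simp
qed

text \<open>Both sides satisfy the same recurrence, so only the case of empty \<open>P\<close> has
  to match. There one element of \<open>Q\<close> supplies the factor that completes (card K)! to
  (card K + 1)!, which accounts for \<open>Suc q\<close> in the hypothesis against \<open>q\<close>
  in the conclusion.\<close>

lemma excount_eq_Hsum:
  assumes "finite K" "finite P" "finite Q" "\<forall>k\<in>K. \<forall>i\<in>P \<union> Q. k < i" "\<forall>i\<in>P. \<forall>j\<in>Q. i < j"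
    and "card Q = Suc q"
  shows "of_nat (excount K P Q) = Hsum (Suc (card K)) (card P) q"
  using assms(1,2,4,5)
proof (induction "card P" arbitrary: K P)
  case 0
  then have "excount K P Q = fact (card K) * (card K + 1) ^ Suc q"
    using excount_no_P[of K Q] assms(3,6) by auto
  then show ?case using 0 by (simp add: Hsum_def gam_coeff_0 alpha_coeff_def algebra_simps)
next
  case (Suc p)
  define m where "m = Min P"
  have ne: "P \<noteq> {}" using Suc by auto
  have mP: "m \<in> P" unfolding m_def using Suc ne by auto
  have lt: "\<forall>i\<in>P - {m}. m < i"
    using Suc.prems(2) by (auto simp: m_def order.strict_iff_order)
  have cP: "card (P - {m}) = p" using Suc.hyps(2) mP Suc.prems(2) by simp
  have mK: "m \<notin> K" using Suc.prems(3) mP by auto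
  have "excount (insert m K) (P - {m}) Q = excount K (insert m (P - {m})) Q + (card K + 1) * excount K (P - {m}) Q"
    by (rule excount_P_step) (use Suc.prems lt mP assms(3) in auto)
  then have "of_nat (excount (insert m K) (P - {m}) Q) =
      (of_nat (excount K P Q) + of_nat (card K + 1) * of_nat (excount K (P - {m}) Q) :: complex)"
    using mP by (simp only: insert_Diff of_nat_add of_nat_mult)
  then have "of_nat (excount K P Q) =
      of_nat (excount (insert m K) (P - {m}) Q) - of_nat (card K + 1) * (of_nat (excount K (P - {m}) Q) :: complex)"
    by (simp only: add_diff_cancel_right')
  also have "of_nat (excount K (P - {m}) Q) = Hsum (Suc (card K)) p q"
    using Suc.hyps(1)[of "P - {m}" K] Suc.prems cP by auto
  also have "of_nat (excount (insert m K) (P - {m}) Q) = Hsum (Suc (Suc (card K))) p q"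
    using Suc.hyps(1)[of "P - {m}" "insert m K"] Suc.prems cP mK lt mP by auto
  finally show ?case using Suc.hyps(2)[symmetric] by (simp add: Hsum_Suc)
qed

text \<open>The last position p + q + 1 is the maximum and can never be an excedance, so adding it
  to the non-excedance set costs nothing.\<close>

lemma ba_count_eq_excount: "ba_count p q = excount {} {1..p} {p+1..p+q+1}"
proof -
  have "(\<pi> permutes {1..p+q+1} \<and> (\<forall>i\<in>{1..p+q}. (\<pi> i > i \<longleftrightarrow> i \<in> {1..p}))) \<longleftrightarrow>
    (\<pi> permutes ({} \<union> {1..p} \<union> {p+1..p+q+1}) \<and> (\<forall>i\<in>{1..p}. \<pi> i > i) \<and> (\<forall>i\<in>{p+1..p+q+1}. \<pi> i \<le> i))"
    for \<pi>
  proof -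
    have U: "{} \<union> {1..p} \<union> {p+1..p+q+1} = {1..p+q+1}" by auto
    have last: "\<pi> (p+q+1) \<le> p+q+1" if "\<pi> permutes {1..p+q+1}"
      using permutes_in_image[OF that, of "p+q+1"] by simp
    have "(\<forall>i\<in>{1..p+q}. (\<pi> i > i \<longleftrightarrow> i \<in> {1..p})) \<longleftrightarrow>
        (\<forall>i\<in>{1..p}. \<pi> i > i) \<and> (\<forall>i\<in>{p+1..p+q}. \<pi> i \<le> i)"
      (is "?L \<longleftrightarrow> ?R")
    proof
      assume ?L
      then have L: "\<pi> i > i \<longleftrightarrow> i \<le> p" if "1 \<le> i" "i \<le> p + q" for i
        using that by simp
      have "\<pi> i \<le> i" if "p + 1 \<le> i" "i \<le> p + q" for i
        using L[of i] that by linarith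
      then show ?R using L by simp
    next
      assume R: ?R
      have "\<pi> i > i \<longleftrightarrow> i \<le> p" if "1 \<le> i" "i \<le> p + q" for i
      proof (cases "i \<le> p")
        case False
        then have "\<pi> i \<le> i" using R that by simp
        then show ?thesis using False by simp
      qed (use R that in simp)
      then show ?L by simp
    qed
    moreover have "{p+1..p+q+1} = insert (p+q+1) {p+1..p+q}" by auto
    ultimately have "(\<forall>i\<in>{1..p+q}. (\<pi> i > i \<longleftrightarrow> i \<in> {1..p})) \<and> \<pi> (p+q+1) \<le> p+q+1 \<longleftrightarrow>
        (\<forall>i\<in>{1..p}. \<pi> i > i) \<and> (\<forall>i\<in>{p+1..p+q+1}. \<pi> i \<le> i)"
      by (simp only: ball_simps(7)) blast
    then show ?thesis unfolding U using last by blast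
  qed
  then have "{\<pi>. \<pi> permutes {1..p+q+1} \<and> (\<forall>i\<in>{1..p+q}. (\<pi> i > i \<longleftrightarrow> i \<in> {1..p}))} =
    {\<pi>. \<pi> permutes ({} \<union> {1..p} \<union> {p+1..p+q+1}) \<and> (\<forall>i\<in>{1..p}. \<pi> i > i) \<and> (\<forall>i\<in>{p+1..p+q+1}. \<pi> i \<le> i)}"
    by (rule Collect_cong)
  then show ?thesis unfolding ba_count_def excount_def by (rule arg_cong)
qed

text \<open>At k = 0 the subtracted term of \<open>Hsum_Suc\<close> vanishes, so
  \<open>Hsum 1 (r - 1) s = Hsum 0 r s\<close>. This removes the shift: r - 1 prescribed excedances
  become the exponent r.\<close>

theorem ba_count_eq_sum:
  assumes "r \<ge> 1"
  shows "of_nat (ba_count (r - 1) s) = fact r * fact s *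
    (\<Sum>j\<le>r. fps_nth (E1 * (E1 - 1) ^ j) r * fps_nth ((E1 - 1) ^ j) s)"
proof -
  obtain p where r: "r = Suc p" using assms by (cases r) auto
  have "of_nat (excount {} {1..p} {p+1..p+s+1}) = Hsum (Suc (card ({} :: nat set))) (card {1..p}) s"
    by (rule excount_eq_Hsum) auto
  then have "of_nat (ba_count p s) = Hsum 1 p s"
    by (simp only: ba_count_eq_excount card.empty card_atLeastAtMost diff_Suc_Suc diff_zero One_nat_def)
  also have "\<dots> = Hsum 0 r s"
    using Hsum_Suc[of 0 p s] r by simp
  finally have "of_nat (ba_count (r - 1) s) = Hsum 0 r s" using r by simp
  also have "\<dots> = (\<Sum>j\<le>r. fact r * fact s * (fps_nth (E1 * (E1 - 1) ^ j) r * fps_nth ((E1 - 1) ^ j) s))"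
    unfolding Hsum_def by (intro sum.cong) (auto simp: alpha_coeff_def gam_coeff_def)
  finally show ?thesis by (simp only: sum_distrib_left)
qed

section \<open>A local limit theorem\<close>

text \<open>AM-GM gives sqrt a |x| \<le> 1 + a x^2 / 2 \<le> e^(a x^2 / 2): a linear factor is
  traded for half of the exponent and a gain of a^(-1/2).\<close>

lemma abs_mult_exp_neg_square_le:
  fixes a x :: real
  assumes "a > 0"
  shows "\<bar>x\<bar> * exp (- a * x\<^sup>2) \<le> exp (- (a / 2) * x\<^sup>2) / sqrt a"
proof -
  have "sqrt a * \<bar>x\<bar> \<le> 1 + a / 2 * x\<^sup>2"
    using arith_geo_mean_sqrt[of 1 "a * x\<^sup>2"] assms by (simp add: real_sqrt_mult)
  also have "\<dots> \<le> exp (a / 2 * x\<^sup>2)" by (rule exp_ge_add_one_self)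
  finally have "(sqrt a * \<bar>x\<bar>) * exp (- a * x\<^sup>2) \<le> exp (a / 2 * x\<^sup>2) * exp (- a * x\<^sup>2)"
    by (intro mult_right_mono) auto
  also have "\<dots> = exp (- (a / 2) * x\<^sup>2)" by (simp flip: exp_add)
  finally show ?thesis using assms by (simp add: field_simps)
qed

section \<open>Gaussian integrals and Cauchy's coefficient formula\<close>

lemma has_bochner_integral_gauss:
  fixes a m :: real
  assumes "a > 0"
  shows "has_bochner_integral lborel (\<lambda>x. exp (- a * (x - m)\<^sup>2)) (sqrt (pi / a))"
proof -
  define s where "s = 1 / sqrt (2 * a)"
  have s: "s > 0" "s\<^sup>2 = 1 / (2 * a)" using assms by (auto simp: s_def power_divide)
  have "has_bochner_integral lborel (\<lambda>x. sqrt (pi / a) * normal_density m s x) (sqrt (pi / a) * 1)"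
    using s by (intro has_bochner_integral_mult_right) (simp add: has_bochner_integral_iff)
  moreover have "sqrt (pi / a) * normal_density m s x = exp (- a * (x - m)\<^sup>2)" for x
    using assms by (simp add: normal_density_def s)
  ultimately show ?thesis by simp
qed

lemmas integrable_gauss = has_bochner_integral_gauss[THEN integrable.intros]

text \<open>The substitution \<theta> = x / sqrt b reduces this to the characteristic function of
  the standard normal distribution.\<close>

lemma gauss_fourier:
  fixes b u :: real
  assumes "b > 0"
  shows "(\<integral>\<theta>. of_real (exp (- (b / 2) * \<theta>\<^sup>2)) * cis (- (u * \<theta>)) \<partial>lborel) =
    complex_of_real (sqrt (2 * pi / b) * exp (- u\<^sup>2 / (2 * b)))"
proof -
  define t where "t = - u / sqrt b"
  have "complex_of_real (exp (- t\<^sup>2 / 2)) = (\<integral>x. std_normal_density x *\<^sub>R iexp (t * x) \<partial>lborel)"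
    using fun_cong[OF char_std_normal_distribution, of t]
    by (subst (asm) char_def, subst (asm) integral_density) auto
  also have "\<dots> = (\<integral>x. of_real (1 / sqrt (2 * pi)) * (of_real (exp (- x\<^sup>2 / 2)) * cis (t * x)) \<partial>lborel)"
    by (intro Bochner_Integration.integral_cong) (auto simp: std_normal_density_def cis_conv_exp scaleR_conv_of_real)
  also have "\<dots> = of_real (1 / sqrt (2 * pi)) * (\<integral>x. of_real (exp (- x\<^sup>2 / 2)) * cis (t * x) \<partial>lborel)"
    by simp
  finally have 1: "(\<integral>x. of_real (exp (- x\<^sup>2 / 2)) * cis (t * x) \<partial>lborel) =
      complex_of_real (sqrt (2 * pi) * exp (- t\<^sup>2 / 2))"
    by (simp add: field_simps)
  have "(\<integral>\<theta>. of_real (exp (- (b / 2) * \<theta>\<^sup>2)) * cis (- (u * \<theta>)) \<partial>lborel) =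
    \<bar>1 / sqrt b\<bar> *\<^sub>R (\<integral>x. of_real (exp (- (b / 2) * (0 + 1 / sqrt b * x)\<^sup>2)) * cis (- (u * (0 + 1 / sqrt b * x))) \<partial>lborel)"
    using assms by (intro lborel_integral_real_affine) auto
  also have "(\<lambda>x. complex_of_real (exp (- (b / 2) * (0 + 1 / sqrt b * x)\<^sup>2)) * cis (- (u * (0 + 1 / sqrt b * x)))) =
      (\<lambda>x. of_real (exp (- x\<^sup>2 / 2)) * cis (t * x))"
    using assms by (auto simp: t_def power_divide fun_eq_iff)
  finally show ?thesis
    unfolding 1 using assms
    by (simp add: t_def power_divide real_sqrt_divide scaleR_conv_of_real)
qed

lemma integral_cis_int:
  fixes k :: int
  shows "((\<lambda>\<theta>. cis (of_int k * \<theta>)) has_integral (if k = 0 then of_real (2 * pi) else 0)) {-pi..pi}"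
proof (cases "k = 0")
  case True
  then show ?thesis using has_integral_const_real[of "1::complex" "-pi" pi]
    by (simp add: scaleR_conv_of_real)
next
  case False
  let ?F = "\<lambda>\<theta>. cis (of_int k * \<theta>) / (\<i> * of_int k)"
  have "((\<lambda>\<theta>. cis (of_int k * \<theta>)) has_integral (?F pi - ?F (-pi))) {-pi..pi}"
  proof (rule fundamental_theorem_of_calculus)
    fix \<theta> :: real
    have "((\<lambda>z. exp (\<i> * of_int k * z) / (\<i> * of_int k)) has_field_derivative exp (\<i> * of_int k * of_real \<theta>)) (at (of_real \<theta>))"
      using False by (auto intro!: derivative_eq_intros)
    from has_vector_derivative_real_field[OF this]
    show "(?F has_vector_derivative cis (of_int k * \<theta>)) (at \<theta> within {-pi..pi})"
      by (simp add: cis_conv_exp mult.assoc)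
  qed simp
  moreover have "cis (of_int k * pi) = cis (of_int k * (- pi))"
  proof -
    have "cis (of_int k * pi) = cis (of_int k * (- pi)) * cis (2 * pi * of_int k)"
      by (simp add: cis_mult algebra_simps)
    also have "cis (2 * pi * of_int k) = 1" by (rule cis_multiple_2pi) auto
    finally show ?thesis by simp
  qed
  ultimately show ?thesis using False by simp
qed

text \<open>Cauchy's formula on the circle of radius \<rho>, by integrating the uniformly convergent
  series term by term; orthogonality of the characters leaves only the term of index m.\<close>

lemma fps_nth_eq_integral:
  fixes F :: "complex fps"
  assumes \<rho>: "\<rho> > 0" and R: "fps_conv_radius F = \<infinity>"
  shows "fps_nth F m * of_real \<rho> ^ m =
    1 / of_real (2 * pi) * integral {-pi..pi} (\<lambda>\<theta>. eval_fps F (of_real \<rho> * cis \<theta>) * cis (- (real m * \<theta>)))"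
proof -
  let ?f = "\<lambda>n \<theta>. fps_nth F n * of_real \<rho> ^ n * cis (of_int (int n - int m) * \<theta>)"
  let ?S = "\<lambda>n \<theta>. \<Sum>i<n. ?f i \<theta>"
  have f_eq: "?f n \<theta> = fps_nth F n * (of_real \<rho> * cis \<theta>) ^ n * cis (- (real m * \<theta>))" for n \<theta>
    by (simp add: power_mult_distrib Complex.DeMoivre cis_mult algebra_simps)
  have sums: "(\<lambda>n. ?f n \<theta>) sums (eval_fps F (of_real \<rho> * cis \<theta>) * cis (- (real m * \<theta>)))" for \<theta>
    unfolding f_eq using R by (intro sums_mult2 sums_eval_fps) simp
  have "summable (\<lambda>n. norm (fps_nth F n * of_real \<rho> ^ n))"
    by (rule norm_summable_fps) (simp add: R)
  then have "uniform_limit {-pi..pi} ?S (\<lambda>\<theta>. \<Sum>n. ?f n \<theta>) sequentially"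
    by (intro Weierstrass_m_test[where M = "\<lambda>n. norm (fps_nth F n * of_real \<rho> ^ n)"]) (auto simp: norm_mult)
  then have ul: "uniform_limit {-pi..pi} ?S (\<lambda>\<theta>. eval_fps F (of_real \<rho> * cis \<theta>) * cis (- (real m * \<theta>))) sequentially"
    using sums by (simp add: sums_iff)
  obtain I J where I: "\<And>n. (?S n has_integral I n) {-pi..pi}"
    and J: "((\<lambda>\<theta>. eval_fps F (of_real \<rho> * cis \<theta>) * cis (- (real m * \<theta>))) has_integral J) {-pi..pi}"
    and lim: "I \<longlonglongrightarrow> J"
    by (rule uniform_limit_integral[OF ul]) (auto intro!: continuous_intros simp: cis_conv_exp)
  have "(?S n has_integral (\<Sum>i<n. fps_nth F i * of_real \<rho> ^ i * (if int i - int m = 0 then of_real (2 * pi) else 0))) {-pi..pi}" for n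
    by (intro has_integral_sum has_integral_mult_right integral_cis_int) auto
  then have I_eq: "I n = (\<Sum>i<n. fps_nth F i * of_real \<rho> ^ i * (if i = m then of_real (2 * pi) else 0))" for n
    using has_integral_unique[OF I] by simp
  have "I n = fps_nth F m * of_real \<rho> ^ m * of_real (2 * pi)" if "n > m" for n
    unfolding I_eq using that by (simp add: if_distrib sum.delta cong: if_cong)
  then have "eventually (\<lambda>n. I n = fps_nth F m * of_real \<rho> ^ m * of_real (2 * pi)) sequentially"
    by (intro eventually_mono[OF eventually_gt_at_top[of m]])
  then have "J = fps_nth F m * of_real \<rho> ^ m * of_real (2 * pi)"
    by (rule LIMSEQ_unique[OF lim tendsto_eventually])
  then show ?thesis using J by (simp add: integral_unique)
qed

text \<open>The point is the surviving power of \<open>M\<close>: with M = e^(-c \<theta>^2) the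
  difference of two j-th powers keeps its Gaussian decay.\<close>

lemma norm_power_diff_le:
  fixes a b :: "'a :: {real_normed_algebra_1, comm_ring_1}"
  assumes "norm a \<le> M" "norm b \<le> M"
  shows "norm (a ^ j - b ^ j) \<le> real j * M ^ (j - 1) * norm (a - b)"
proof (induction j)
  case (Suc j)
  have M: "M \<ge> 0" using assms norm_ge_zero[of a] by linarith
  show ?case
  proof (cases j)
    case (Suc i)
    have "a ^ Suc j - b ^ Suc j = a * (a ^ j - b ^ j) + (a - b) * b ^ j"
      by (simp add: algebra_simps)
    also have "norm \<dots> \<le> norm a * norm (a ^ j - b ^ j) + norm (a - b) * norm (b ^ j)"
      by (intro norm_triangle_le add_mono norm_mult_ineq)
    also have "\<dots> \<le> M * (real j * M ^ (j - 1) * norm (a - b)) + norm (a - b) * M ^ j"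
      by (intro add_mono mult_mono assms Suc.IH order_trans[OF norm_power_ineq] power_mono) (use M in auto)
    also have "\<dots> = real (Suc j) * M ^ (Suc j - 1) * norm (a - b)"
      by (simp add: Suc algebra_simps)
    finally show ?thesis .
  qed simp
qed simp

section \<open>Comparison of a Fourier integral with its Gaussian\<close>

text \<open>The centred normal density, parametrised by the variance rather than by the standard
  deviation.\<close>

definition gdens :: "real \<Rightarrow> real \<Rightarrow> real" where
  "gdens w t = exp (- t\<^sup>2 / (2 * w)) / sqrt (2 * pi * w)"

text \<open>In the bracket, \<open>L\<close> comes from \<psi> - 1, the summand 1 from the Gaussian
  tail beyond pi, and the last term from the difference of j-th powers. The outer factor is j / (2
  pi) times the integral of the majorant of |\<theta>| e^(-(c j / 2) \<theta>^2).\<close>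

definition llt_const :: "real \<Rightarrow> real \<Rightarrow> real \<Rightarrow> real" where
  "llt_const c K L = (L + 1 + 2 * K * exp (c * pi\<^sup>2) / c) * sqrt (2 * pi) / (c * pi)"

text \<open>Both sides are Fourier integrals, and their integrands differ by at most a constant
  times |\<theta>| e^(-(c j / 2) \<theta>^2), whose integral has order 1/j. The hypothesis
  \<open>v \<ge> 2 * c\<close> puts the limiting Gaussian under the same majorant as \<phi>.\<close>

lemma local_limit_bound:
  fixes \<phi> \<psi> :: "real \<Rightarrow> complex"
  assumes c: "c > 0" and v: "v \<ge> 2 * c" and K: "K \<ge> 0" and L: "L \<ge> 0"
    and cont: "continuous_on {-pi..pi} \<phi>" "continuous_on {-pi..pi} \<psi>"
    and \<phi>: "\<And>\<theta>. \<bar>\<theta>\<bar> \<le> pi \<Longrightarrow> cmod (\<phi> \<theta>) \<le> exp (- c * \<theta>\<^sup>2)"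
    and \<phi>2: "\<And>\<theta>. \<bar>\<theta>\<bar> \<le> pi \<Longrightarrow> cmod (\<phi> \<theta> * cis (- (\<mu> * \<theta>)) - of_real (exp (- (v / 2) * \<theta>\<^sup>2))) \<le> K * \<bar>\<theta>\<bar> ^ 3"
    and \<psi>: "\<And>\<theta>. \<bar>\<theta>\<bar> \<le> pi \<Longrightarrow> cmod (\<psi> \<theta> - 1) \<le> L * \<bar>\<theta>\<bar>"
    and j: "j \<ge> 1"
  shows "cmod (1 / of_real (2 * pi) * integral {-pi..pi} (\<lambda>\<theta>. \<psi> \<theta> * \<phi> \<theta> ^ j * cis (- (m * \<theta>)))
    - of_real (gdens (real j * v) (m - real j * \<mu>))) \<le> llt_const c K L / real j"
proof -
  define u where "u = m - real j * \<mu>"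
  define C where "C = L + 1 + 2 * K * exp (c * pi\<^sup>2) / c"
  define g1 where "g1 = (\<lambda>\<theta>. \<psi> \<theta> * \<phi> \<theta> ^ j * cis (- (m * \<theta>)))"
  define g2 where "g2 = (\<lambda>\<theta>. complex_of_real (exp (- (real j * v / 2) * \<theta>\<^sup>2)) * cis (- (u * \<theta>)))"
  define D where "D = (\<lambda>\<theta>. C * (\<bar>\<theta>\<bar> * exp (- (c * real j / 2) * \<theta>\<^sup>2)))"
  have C1: "C \<ge> 1" using K L c by (simp add: C_def)
  have cj: "c * real j > 0" "real j * v > 0" using c v j by auto
  have in_bound: "cmod (g1 \<theta> - g2 \<theta>) \<le> D \<theta>" if t: "\<bar>\<theta>\<bar> \<le> pi" for \<theta>
  proof -
    define a where "a = \<phi> \<theta> * cis (- (\<mu> * \<theta>))"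
    define b where "b = complex_of_real (exp (- (v / 2) * \<theta>\<^sup>2))"
    define M where "M = exp (- c * \<theta>\<^sup>2)"
    have a: "cmod a \<le> M" using \<phi>[OF t] by (simp add: a_def M_def norm_mult)
    have "c * \<theta>\<^sup>2 \<le> v / 2 * \<theta>\<^sup>2" using v by (intro mult_right_mono) auto
    then have b: "cmod b \<le> M" by (simp add: b_def M_def)
    have Mj: "M ^ j = exp (- (c * real j) * \<theta>\<^sup>2)"
      by (simp add: M_def exp_of_nat_mult[symmetric] algebra_simps)
    have aj: "a ^ j = \<phi> \<theta> ^ j * cis (- (real j * \<mu> * \<theta>))"
      by (simp add: a_def power_mult_distrib Complex.DeMoivre algebra_simps)
    have bj: "b ^ j = of_real (exp (- (real j * v / 2) * \<theta>\<^sup>2))"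
      unfolding b_def of_real_power[symmetric] exp_of_nat_mult[symmetric] by (simp add: algebra_simps)
    have "g1 \<theta> = \<psi> \<theta> * a ^ j * cis (- (u * \<theta>))"
      by (simp add: g1_def aj u_def cis_mult algebra_simps)
    moreover have "g2 \<theta> = b ^ j * cis (- (u * \<theta>))"
      by (simp add: g2_def bj)
    ultimately have "g1 \<theta> - g2 \<theta> = ((\<psi> \<theta> - 1) * a ^ j + (a ^ j - b ^ j)) * cis (- (u * \<theta>))"
      by (simp add: algebra_simps)
    then have "cmod (g1 \<theta> - g2 \<theta>) = cmod ((\<psi> \<theta> - 1) * a ^ j + (a ^ j - b ^ j))"
      by (simp add: norm_mult)
    also have "\<dots> \<le> cmod (\<psi> \<theta> - 1) * cmod a ^ j + cmod (a ^ j - b ^ j)"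
      by (rule order_trans[OF norm_triangle_ineq]) (simp add: norm_mult norm_power)
    also have "\<dots> \<le> L * \<bar>\<theta>\<bar> * M ^ j + real j * M ^ (j - 1) * (K * \<bar>\<theta>\<bar> ^ 3)"
    proof (intro add_mono mult_mono power_mono order_trans[OF norm_power_diff_le[OF a b]])
      show "cmod (a - b) \<le> K * \<bar>\<theta>\<bar> ^ 3" using \<phi>2[OF t] by (simp add: a_def b_def)
    qed (use a L \<psi>[OF t] in \<open>auto simp: M_def\<close>)
    also have "real j * M ^ (j - 1) * (K * \<bar>\<theta>\<bar> ^ 3) \<le> 2 * K * exp (c * pi\<^sup>2) / c * (\<bar>\<theta>\<bar> * exp (- (c * real j / 2) * \<theta>\<^sup>2))"
    proof -
      \<comment> \<open>The missing factor of \<open>M\<close> is restored at the price of the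
        constant e^(c pi^2).\<close>
      have "M ^ (j - 1) = M ^ j * exp (c * \<theta>\<^sup>2)"
        using j by (cases j) (auto simp: M_def simp flip: exp_add)
      also have "\<dots> \<le> M ^ j * exp (c * pi\<^sup>2)"
        using c t by (intro mult_left_mono) (auto simp: M_def intro!: mult_left_mono power_mono_even abs_le_square_iff[THEN iffD1])
      finally have M1: "M ^ (j - 1) \<le> M ^ j * exp (c * pi\<^sup>2)" .
      \<comment> \<open>The cubic error is multiplied by j; two of its three powers of \<theta>
        combine with j, and j \<theta>^2 is absorbed by half of the exponent via t \<le> e^t. One
        power of \<theta> is left.\<close>
      have "c * real j / 2 * \<theta>\<^sup>2 \<le> exp (c * real j / 2 * \<theta>\<^sup>2)"
        using exp_ge_add_one_self[of "c * real j / 2 * \<theta>\<^sup>2"] by linarith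
      then have "real j * \<theta>\<^sup>2 \<le> 2 / c * exp (c * real j / 2 * \<theta>\<^sup>2)"
        using c by (simp add: field_simps)
      then have "real j * \<theta>\<^sup>2 * M ^ j \<le> 2 / c * exp (c * real j / 2 * \<theta>\<^sup>2) * M ^ j"
        by (intro mult_right_mono) (auto simp: M_def)
      also have "\<dots> = 2 / c * exp (- (c * real j / 2) * \<theta>\<^sup>2)"
        unfolding Mj by (simp flip: exp_add) 
      finally have M2: "real j * \<theta>\<^sup>2 * M ^ j \<le> 2 / c * exp (- (c * real j / 2) * \<theta>\<^sup>2)" .
      have "real j * M ^ (j - 1) * (K * \<bar>\<theta>\<bar> ^ 3) \<le> real j * (M ^ j * exp (c * pi\<^sup>2)) * (K * \<bar>\<theta>\<bar> ^ 3)"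
        using M1 K by (intro mult_right_mono mult_left_mono) auto
      also have "\<dots> = K * \<bar>\<theta>\<bar> * exp (c * pi\<^sup>2) * (real j * \<theta>\<^sup>2 * M ^ j)"
      proof -
        have "\<bar>\<theta>\<bar> ^ 3 = \<bar>\<theta>\<bar> * \<theta>\<^sup>2" by (simp add: power3_eq_cube power2_eq_square)
        then show ?thesis by (simp only: mult_ac)
      qed
      also have "\<dots> \<le> K * \<bar>\<theta>\<bar> * exp (c * pi\<^sup>2) * (2 / c * exp (- (c * real j / 2) * \<theta>\<^sup>2))"
        using M2 K by (intro mult_left_mono) auto
      finally show ?thesis by (simp add: algebra_simps)
    qed
    also have "L * \<bar>\<theta>\<bar> * M ^ j \<le> (L + 1) * (\<bar>\<theta>\<bar> * exp (- (c * real j / 2) * \<theta>\<^sup>2))"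
    proof -
      have "M ^ j \<le> exp (- (c * real j / 2) * \<theta>\<^sup>2)" unfolding Mj using c by simp
      then have "L * \<bar>\<theta>\<bar> * M ^ j \<le> (L + 1) * \<bar>\<theta>\<bar> * exp (- (c * real j / 2) * \<theta>\<^sup>2)"
        using L by (intro mult_mono) (auto simp: M_def)
      then show ?thesis by (simp add: mult.assoc)
    qed
    finally show ?thesis by (simp add: D_def C_def algebra_simps)
  qed
  \<comment> \<open>Beyond pi only the Gaussian is present. Since |\<theta>| \<ge> 1 and
    \<open>C \<ge> 1\<close> there, the same majorant \<open>D\<close> covers it.\<close>
  have out_bound: "cmod (g2 \<theta>) \<le> D \<theta>" if t: "\<bar>\<theta>\<bar> \<ge> pi" for \<theta>
  proof -
    have "\<bar>\<theta>\<bar> \<ge> 1" using t pi_ge_two by linarith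
    have "c * real j * \<theta>\<^sup>2 \<le> v * real j * \<theta>\<^sup>2" using v c by (intro mult_right_mono) auto
    then have "cmod (g2 \<theta>) \<le> exp (- (c * real j / 2) * \<theta>\<^sup>2)"
      by (simp add: g2_def norm_mult algebra_simps)
    also have "\<dots> = 1 * (1 * exp (- (c * real j / 2) * \<theta>\<^sup>2))" by simp
    also have "\<dots> \<le> D \<theta>" unfolding D_def using C1 \<open>\<bar>\<theta>\<bar> \<ge> 1\<close> by (intro mult_mono) auto
    finally show ?thesis .
  qed
  let ?G1 = "\<lambda>\<theta>. indicator {-pi..pi} \<theta> *\<^sub>R g1 \<theta>"
  have cont1: "continuous_on {-pi..pi} g1"
    unfolding g1_def cis_conv_exp by (intro continuous_intros cont)
  have int1: "set_integrable lborel {-pi..pi} g1"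
    by (rule borel_integrable_atLeastAtMost'[OF cont1])
  have I1: "integrable lborel ?G1" using int1 by (simp add: set_integrable_def)
  have I1e: "(\<integral>\<theta>. ?G1 \<theta> \<partial>lborel) = integral {-pi..pi} g1"
    using set_borel_integral_eq_integral(2)[OF int1] by (simp add: set_lebesgue_integral_def)
  have meas2: "g2 \<in> borel_measurable lborel"
    unfolding g2_def cis_conv_exp by measurable
  have I2: "integrable lborel g2"
    by (rule Bochner_Integration.integrable_bound[OF integrable_gauss[of "real j * v / 2" 0] meas2])
      (use cj in \<open>auto simp: g2_def norm_mult\<close>)
  have I2e: "(\<integral>\<theta>. g2 \<theta> \<partial>lborel) = of_real (sqrt (2 * pi / (real j * v)) * exp (- u\<^sup>2 / (2 * (real j * v))))"
    unfolding g2_def by (rule gauss_fourier[OF cj(2)])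
  have DI: "D \<theta> \<le> C * (exp (- (c * real j / 2 / 2) * (\<theta> - 0)\<^sup>2) / sqrt (c * real j / 2))" for \<theta>
    unfolding D_def using abs_mult_exp_neg_square_le[of "c * real j / 2" \<theta>] cj C1
    by (intro mult_left_mono) auto
  let ?D2 = "\<lambda>\<theta>. C * (exp (- (c * real j / 2 / 2) * (\<theta> - 0)\<^sup>2) / sqrt (c * real j / 2))"
  have hD2: "has_bochner_integral lborel ?D2 (C * (sqrt (pi / (c * real j / 2 / 2)) / sqrt (c * real j / 2)))"
    using cj by (intro has_bochner_integral_mult_right has_bochner_integral_divide has_bochner_integral_gauss) auto
  have "cmod (integral {-pi..pi} g1 - (\<integral>\<theta>. g2 \<theta> \<partial>lborel)) = cmod (\<integral>\<theta>. ?G1 \<theta> - g2 \<theta> \<partial>lborel)"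
    using I1 I2 by (simp add: I1e)
  also have "\<dots> \<le> (\<integral>\<theta>. ?D2 \<theta> \<partial>lborel)"
  proof (rule Bochner_Integration.integral_norm_bound_integral)
    show "integrable lborel (\<lambda>\<theta>. ?G1 \<theta> - g2 \<theta>)" using I1 I2 by simp
    show "integrable lborel ?D2" using hD2 by (rule integrable.intros)
    fix \<theta> :: real
    have "cmod (?G1 \<theta> - g2 \<theta>) \<le> D \<theta>"
      using in_bound[of \<theta>] out_bound[of \<theta>] by (cases "\<bar>\<theta>\<bar> \<le> pi") (auto simp: indicator_def)
    then show "cmod (?G1 \<theta> - g2 \<theta>) \<le> ?D2 \<theta>" using DI[of \<theta>] by linarith
  qed
  also have "\<dots> = C * (sqrt (pi / (c * real j / 2 / 2)) / sqrt (c * real j / 2))"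
    using hD2 by (rule has_bochner_integral_integral_eq)
  also have "\<dots> = C * (2 * sqrt (2 * pi) / (c * real j))"
  proof -
    have "sqrt (pi / (c * real j / 2 / 2)) / sqrt (c * real j / 2) = sqrt (2\<^sup>2 * (2 * pi) / (c * real j)\<^sup>2)"
      using cj by (simp add: field_simps power2_eq_square flip: real_sqrt_divide)
    also have "\<dots> = 2 * sqrt (2 * pi) / (c * real j)"
      using cj by (simp only: real_sqrt_divide real_sqrt_mult real_sqrt_abs abs_of_pos abs_numeral)
    finally show ?thesis by simp
  qed
  finally have main: "cmod (integral {-pi..pi} g1 - (\<integral>\<theta>. g2 \<theta> \<partial>lborel)) \<le> C * (2 * sqrt (2 * pi) / (c * real j))" .
  have gd: "complex_of_real (gdens (real j * v) u) = 1 / of_real (2 * pi) * (\<integral>\<theta>. g2 \<theta> \<partial>lborel)"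
  proof -
    have "gdens (real j * v) u = 1 / (2 * pi) * (sqrt (2 * pi / (real j * v)) * exp (- u\<^sup>2 / (2 * (real j * v))))"
    proof -
      have "sqrt (2 * pi / w) = 2 * pi / sqrt (2 * pi * w)" if "w > 0" for w :: real
      proof -
        have "sqrt (2 * pi / w) = sqrt ((2 * pi)\<^sup>2 / (2 * pi * w))"
          using that by (simp add: power2_eq_square)
        then show ?thesis by (simp only: real_sqrt_divide real_sqrt_abs) simp
      qed
      from this[OF cj(2)] show ?thesis by (simp add: gdens_def)
    qed
    then show ?thesis unfolding I2e by simp
  qed
  have "cmod (1 / of_real (2 * pi) * integral {-pi..pi} g1 - of_real (gdens (real j * v) u)) =
      cmod (1 / of_real (2 * pi) * (integral {-pi..pi} g1 - (\<integral>\<theta>. g2 \<theta> \<partial>lborel)))"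
    unfolding gd by (simp add: algebra_simps)
  also have "\<dots> = 1 / (2 * pi) * cmod (integral {-pi..pi} g1 - (\<integral>\<theta>. g2 \<theta> \<partial>lborel))"
    by (simp add: norm_mult norm_divide)
  also have "\<dots> \<le> 1 / (2 * pi) * (C * (2 * sqrt (2 * pi) / (c * real j)))"
    using main by (intro mult_left_mono) auto
  also have "\<dots> = llt_const c K L / real j"
    unfolding llt_const_def C_def[symmetric] by simp
  finally show ?thesis by (simp add: g1_def u_def)
qed

section \<open>Zero-truncated Poisson variables\<close>

definition tpois_mean :: "real \<Rightarrow> real" where "tpois_mean x = x / (1 - exp (- x))"
definition tpois_var :: "real \<Rightarrow> real" where "tpois_var x = tpois_mean x * (1 + x - tpois_mean x)"
definition tpois_char :: "real \<Rightarrow> real \<Rightarrow> complex" where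
  "tpois_char x \<theta> = (exp (of_real x * cis \<theta>) - 1) / of_real (exp x - 1)"
definition pois_char :: "real \<Rightarrow> real \<Rightarrow> complex" where
  "pois_char x \<theta> = exp (of_real x * cis \<theta>) / of_real (exp x)"

definition tpois_prob :: "real \<Rightarrow> nat \<Rightarrow> real" where
  "tpois_prob x k = (if k = 0 then 0 else x ^ k / fact k / (exp x - 1))"

text \<open>The tilted coefficient: the probability that j independent zero-truncated Poisson
  variables with parameter x sum to s. In \<open>Acoef\<close> the extra e^z / e^x adds one
  independent Poisson variable.\<close>

definition Bcoef :: "real \<Rightarrow> nat \<Rightarrow> nat \<Rightarrow> complex" where
  "Bcoef x s j = fps_nth ((fps_exp 1 - 1) ^ j) s * of_real x ^ s / of_real (exp x - 1) ^ j"

definition Acoef :: "real \<Rightarrow> nat \<Rightarrow> nat \<Rightarrow> complex" where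
  "Acoef x r j = fps_nth (fps_exp 1 * (fps_exp 1 - 1) ^ j) r * of_real x ^ r / (of_real (exp x) * of_real (exp x - 1) ^ j)"

text \<open>The three arguments are the constants of \<open>norm_tpois_char_le\<close>,
  \<open>tpois_char_taylor\<close> and \<open>norm_pois_char_minus_one_le\<close>.\<close>

definition llt_C :: real where
  "llt_C = llt_const (1 / 648) (3 * exp (2 + exp 1) + 4) (exp 2)"

section \<open>Elementary estimates for the exponential and the cosine\<close>

lemma exp_sums_divide: "(\<lambda>k. z ^ k / fact k) sums exp (z :: 'a :: {banach, real_normed_field})"
  using exp_converges[of z] by (simp add: scaleR_conv_of_real field_simps)

lemma norm_exp_minus_one_le: "norm (exp z - 1) \<le> exp (norm z) - 1"
  for z :: "'a :: {banach, real_normed_field}"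
proof -
  have "(\<lambda>k. z ^ Suc k / fact (Suc k)) sums (exp z - 1)"
    using sums_split_initial_segment[OF exp_sums_divide[of z], of 1] by simp
  moreover have "(\<lambda>k. norm z ^ Suc k / fact (Suc k)) sums (exp (norm z) - 1)"
    using sums_split_initial_segment[OF exp_sums_divide[of "norm z"], of 1] by simp
  ultimately show ?thesis
    by (rule norm_sums_le) (simp add: norm_divide norm_power norm_mult del: fact_Suc of_nat_Suc)
qed

text \<open>The remainder of the series has positive coefficients, so it is dominated by its value
  at |z|.\<close>

lemma norm_exp_minus_quadratic_le:
  "norm (exp z - 1 - z - z\<^sup>2 / 2) \<le> exp (norm z) - 1 - norm z - (norm z)\<^sup>2 / 2"
  for z :: "'a :: {banach, real_normed_field}"
proof -
  have eq: "(\<Sum>i<3. w ^ i / fact i) = 1 + w + w\<^sup>2 / 2" for w :: "'b :: {banach, real_normed_field}"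
    by (simp add: numeral_3_eq_3 power2_eq_square)
  have "(\<lambda>k. z ^ (k + 3) / fact (k + 3)) sums (exp z - (1 + z + z\<^sup>2 / 2))"
    using sums_split_initial_segment[OF exp_sums_divide[of z], of 3] unfolding eq .
  moreover have "(\<lambda>k. norm z ^ (k + 3) / fact (k + 3)) sums (exp (norm z) - (1 + norm z + (norm z)\<^sup>2 / 2))"
    using sums_split_initial_segment[OF exp_sums_divide[of "norm z"], of 3] unfolding eq .
  ultimately have "norm (exp z - (1 + z + z\<^sup>2 / 2)) \<le> exp (norm z) - (1 + norm z + (norm z)\<^sup>2 / 2)"
    by (rule norm_sums_le) (simp add: norm_divide norm_power norm_mult)
  then show ?thesis by (simp add: algebra_simps)
qed

lemma norm_cis_minus_one_le: "cmod (cis t - 1) \<le> \<bar>t\<bar>"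
  using iexp_approx1[of t 0] by (simp add: cis_conv_exp)

lemma norm_cis_minus_quadratic_le: "cmod (cis t - of_real (1 - t\<^sup>2 / 2) - \<i> * of_real t) \<le> \<bar>t\<bar> ^ 3 / 6"
proof -
  have "(\<Sum>k\<le>2. (\<i> * complex_of_real t) ^ k / fact k) = of_real (1 - t\<^sup>2 / 2) + \<i> * of_real t"
    by (simp add: numeral_2_eq_2 power_mult_distrib)
  then have "cmod (cis t - (of_real (1 - t\<^sup>2 / 2) + \<i> * of_real t)) \<le> \<bar>t\<bar> ^ 3 / 6"
    using iexp_approx1[of t 2] by (simp add: cis_conv_exp fact_numeral)
  then show ?thesis by (simp only: diff_diff_eq)
qed

text \<open>The fourth-order Taylor bound gives 1 - cos t \<ge> t^2 / 2 - t^4 / 24, and t^2 \<le> 10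
  on the interval leaves 1/2 - 10/24 = 1/12.\<close>

lemma one_minus_cos_ge:
  assumes "\<bar>t\<bar> \<le> pi"
  shows "1 - cos t \<ge> t\<^sup>2 / 12"
proof -
  have "(\<Sum>k\<le>3. (\<i> * complex_of_real t) ^ k / fact k) = of_real (1 - t\<^sup>2 / 2) + \<i> * of_real (t - t ^ 3 / 6)"
    by (simp add: numeral_3_eq_3 power_mult_distrib algebra_simps power2_eq_square)
  then have "cmod (cis t - (of_real (1 - t\<^sup>2 / 2) + \<i> * of_real (t - t ^ 3 / 6))) \<le> \<bar>t\<bar> ^ 4 / 24"
    using iexp_approx1[of t 3] by (simp add: cis_conv_exp fact_numeral)
  then have "\<bar>Re (cis t - (of_real (1 - t\<^sup>2 / 2) + \<i> * of_real (t - t ^ 3 / 6)))\<bar> \<le> \<bar>t\<bar> ^ 4 / 24"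
    using abs_Re_le_cmod order_trans by blast
  then have "\<bar>cos t - (1 - t\<^sup>2 / 2)\<bar> \<le> \<bar>t\<bar> ^ 4 / 24" by simp
  then have "cos t - (1 - t\<^sup>2 / 2) \<le> \<bar>t\<bar> ^ 4 / 24" by linarith
  moreover have "\<bar>t\<bar> ^ 4 / 24 = t\<^sup>2 * t\<^sup>2 / 24" by (simp flip: power_add)
  moreover have "t\<^sup>2 \<le> 10"
  proof -
    have "pi \<le> 63 / 20" using pi_approx(2) by simp
    then have "\<bar>t\<bar>\<^sup>2 \<le> (63 / 20)\<^sup>2" using assms by (intro power_mono) auto
    then show ?thesis by (simp add: power2_eq_square)
  qed
  then have "t\<^sup>2 * t\<^sup>2 / 24 \<le> t\<^sup>2 * 10 / 24" by (intro divide_right_mono mult_left_mono) auto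
  ultimately show ?thesis by (simp add: field_simps)
qed

section \<open>Coefficient bounds for powers of e^z - 1\<close>

lemma fps_nth_bound:
  fixes F :: "complex fps"
  assumes \<rho>: "\<rho> > 0" and R: "fps_conv_radius F = \<infinity>"
    and B: "\<And>\<theta>. cmod (eval_fps F (of_real \<rho> * cis \<theta>)) \<le> B"
  shows "cmod (fps_nth F m) * \<rho> ^ m \<le> B"
proof -
  let ?g = "\<lambda>\<theta>. eval_fps F (of_real \<rho> * cis \<theta>) * cis (- (real m * \<theta>))"
  have "norm (integral {-pi..pi} ?g) \<le> B * (pi - (- pi))"
  proof (rule integral_bound)
    show "continuous_on {-pi..pi} ?g"
      using R by (auto intro!: continuous_intros simp: cis_conv_exp)
  qed (use B in \<open>auto simp: norm_mult\<close>)
  then have "norm (1 / complex_of_real (2 * pi) * integral {-pi..pi} ?g) \<le> B"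
    unfolding norm_mult by (simp add: norm_divide divide_le_eq mult_ac)
  moreover have "cmod (fps_nth F m) * \<rho> ^ m = norm (fps_nth F m * of_real \<rho> ^ m)"
    using \<rho> by (simp add: norm_mult norm_power)
  ultimately show ?thesis
    by (simp only: fps_nth_eq_integral[OF \<rho> R])
qed

lemma fps_conv_radius_exp_minus_one_power:
  "fps_conv_radius ((fps_exp 1 - 1) ^ j :: complex fps) = \<infinity>"
  "fps_conv_radius (fps_exp 1 * (fps_exp 1 - 1) ^ j :: complex fps) = \<infinity>"
proof -
  have r: "fps_conv_radius (fps_exp 1 - 1 :: complex fps) = \<infinity>"
    using fps_conv_radius_diff[of "fps_exp 1 :: complex fps" 1]
    by (simp only: fps_conv_radius_exp fps_conv_radius_1 min.idem ereal_infty_less_eq)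
  show 1: "fps_conv_radius ((fps_exp 1 - 1) ^ j :: complex fps) = \<infinity>"
    using fps_conv_radius_power[of "fps_exp 1 - 1 :: complex fps" j]
    by (simp only: r ereal_infty_less_eq)
  show "fps_conv_radius (fps_exp 1 * (fps_exp 1 - 1) ^ j :: complex fps) = \<infinity>"
    using fps_conv_radius_mult[of "fps_exp 1 :: complex fps" "(fps_exp 1 - 1) ^ j"]
    by (simp only: 1 fps_conv_radius_exp min.idem ereal_infty_less_eq)
qed

lemma eval_fps_exp_minus_one_power:
  "eval_fps ((fps_exp 1 - 1) ^ j) z = (exp z - 1 :: complex) ^ j"
  "eval_fps (fps_exp 1 * (fps_exp 1 - 1) ^ j) z = exp z * (exp z - 1 :: complex) ^ j"
proof -
  have r: "fps_conv_radius (fps_exp 1 - 1 :: complex fps) = \<infinity>"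
    using fps_conv_radius_exp_minus_one_power(1)[of 1] by (simp only: power_one_right)
  have "eval_fps (fps_exp 1 - 1 :: complex fps) z = exp z - 1"
    by (subst eval_fps_diff) simp_all
  then show 1: "eval_fps ((fps_exp 1 - 1) ^ j) z = (exp z - 1 :: complex) ^ j"
    by (subst eval_fps_power) (simp_all only: r less_ereal.simps)
  show "eval_fps (fps_exp 1 * (fps_exp 1 - 1) ^ j) z = exp z * (exp z - 1 :: complex) ^ j"
    by (subst eval_fps_mult) (simp_all only: fps_conv_radius_exp_minus_one_power 1 fps_conv_radius_exp less_ereal.simps eval_fps_exp mult_1_left)
qed

section \<open>Truncated Poisson estimates, uniform for parameters in [1/3, 1]\<close>

context
  fixes x :: real
  assumes x: "1 / 3 \<le> x" "x \<le> 1"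
begin

lemma exp_minus_one_pos: "exp x - 1 > 0" "exp x - 1 \<ge> x" "exp x - 1 \<le> 2"
proof -
  show "exp x - 1 \<ge> x" using exp_ge_add_one_self[of x] by linarith
  then show "exp x - 1 > 0" using x by linarith
  have "exp x \<le> exp 1" using x by simp
  then show "exp x - 1 \<le> 2" using exp_le by linarith
qed

lemma tpois_mean_alt: "tpois_mean x = x * exp x / (exp x - 1)"
  using exp_minus_one_pos(1) by (simp add: tpois_mean_def exp_minus field_simps)

text \<open>The inequality e^t \<ge> 1 + t at t = -x and t = x places the mean between 1 and 1 +
  x.\<close>

lemma tpois_mean_bounds: "1 \<le> tpois_mean x" "tpois_mean x \<le> 2"
proof -
  have p: "1 - exp (- x) > 0" using x by simp
  have "1 - exp (- x) \<le> x" using exp_ge_add_one_self[of "- x"] by linarith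
  then show "1 \<le> tpois_mean x" using p by (simp add: tpois_mean_def)
  have "exp (- x) \<le> 1 / (1 + x)"
    using exp_ge_add_one_self[of x] x by (simp add: exp_minus field_simps)
  then have "x \<le> (1 + x) * (1 - exp (- x))" using x by (simp add: field_simps)
  also have "\<dots> \<le> 2 * (1 - exp (- x))" using x p by (intro mult_right_mono) auto
  finally show "tpois_mean x \<le> 2" using p by (simp add: tpois_mean_def field_simps)
qed

text \<open>The second factor of the variance is (1 - (1 + x) e^(-x)) / (1 - e^(-x)). Its numerator
  is at least e^(-x) x^2 / 2 \<ge> 1/54 and its denominator at most 2/3, because x and e^(-x) are
  both at least 1/3.\<close>

lemma tpois_var_bounds: "1 / 45 \<le> tpois_var x" "tpois_var x \<le> 2"
proof -
  have p: "1 - exp (- x) > 0" using x by simp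
  have "exp x \<ge> 1 + x + x\<^sup>2 / 2" using x by (intro exp_lower_Taylor_quadratic) auto
  then have "exp (- x) * (1 + x + x\<^sup>2 / 2) \<le> exp (- x) * exp x" by (intro mult_left_mono) auto
  then have A: "exp (- x) * (1 + x + x\<^sup>2 / 2) \<le> 1" by (simp flip: exp_add)
  have "exp (- x) * (5 / 2) \<ge> exp (- x) * (1 + x + x\<^sup>2 / 2)"
    using x power_le_one[of x 2] by (intro mult_left_mono) auto
  have e3: "exp (- x) \<ge> 1 / 3"
  proof -
    have "exp x \<le> 3" using exp_minus_one_pos(3) by linarith
    then show ?thesis by (simp add: exp_minus field_simps)
  qed
  have B: "1 - (1 + x) * exp (- x) \<ge> 1 / 54"
  proof -
    have "1 / 3 * ((1 / 3)\<^sup>2 / 2) \<le> exp (- x) * (x\<^sup>2 / 2)"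
      using x e3 by (intro mult_mono divide_right_mono power_mono) auto
    then show ?thesis using A by (simp add: algebra_simps power2_eq_square)
  qed
  have q: "1 + x - tpois_mean x = (1 - (1 + x) * exp (- x)) / (1 - exp (- x))"
    using p by (simp add: tpois_mean_def field_simps)
  have q23: "1 - exp (- x) \<le> 2 / 3" using e3 by linarith
  have "1 / 45 \<le> (1 / 54) / (2 / 3 :: real)" by simp
  also have "\<dots> \<le> 1 + x - tpois_mean x" unfolding q using B q23 p by (intro frac_le) auto
  finally have C: "1 / 45 \<le> 1 + x - tpois_mean x" .
  show "1 / 45 \<le> tpois_var x" unfolding tpois_var_def
    using mult_mono[of 1 "tpois_mean x" "1/45" "1 + x - tpois_mean x"] C tpois_mean_bounds by simp
  have "tpois_var x \<le> 2 * 1" unfolding tpois_var_def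
    using x C tpois_mean_bounds by (intro mult_mono) auto
  then show "tpois_var x \<le> 2" by simp
qed

text \<open>All cancellation is taken from the first two terms of e^w - 1, namely w (1 + w/2): the
  modulus of 1 + w/2 falls below 1 + x/2 by at least \<theta>^2 / 108. The remaining terms are
  bounded by their moduli. Since x \<ge> 1/3 and e^x - 1 \<le> 2, the relative loss is at least
  \<theta>^2 / 648.\<close>

lemma norm_tpois_char_le:
  assumes t: "\<bar>\<theta>\<bar> \<le> pi"
  shows "cmod (tpois_char x \<theta>) \<le> exp (- (1 / 648) * \<theta>\<^sup>2)"
proof -
  define w where "w = of_real x * cis \<theta>"
  define A where "A = 1 + x / 2"
  define B where "B = x * (1 - cos \<theta>)"
  have A: "A > 0" "A \<le> 3 / 2" using x by (auto simp: A_def)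
  have B: "B \<ge> 0" "B / (2 * A) \<le> A"
  proof -
    show "B \<ge> 0" using x by (auto simp: B_def)
    have "B \<le> x * 2" unfolding B_def using x cos_ge_minus_one[of \<theta>] by (intro mult_left_mono) auto
    also have "\<dots> \<le> 2 * A * A" using x zero_le_square[of x] by (simp add: A_def field_simps)
    finally show "B / (2 * A) \<le> A" using A by (simp add: field_simps)
  qed
  have nw: "cmod w = x" using x by (simp add: w_def norm_mult)
  have "(cmod (1 + w / 2))\<^sup>2 = (1 + x * cos \<theta> / 2)\<^sup>2 + (x * sin \<theta> / 2)\<^sup>2"
    by (simp add: cmod_power2 w_def)
  also have "(x * sin \<theta> / 2)\<^sup>2 = x\<^sup>2 * (1 - (cos \<theta>)\<^sup>2) / 4"
    by (simp add: power_mult_distrib power_divide sin_squared_eq)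
  also have "(1 + x * cos \<theta> / 2)\<^sup>2 + x\<^sup>2 * (1 - (cos \<theta>)\<^sup>2) / 4 = A\<^sup>2 - B"
    by (simp add: A_def B_def power2_eq_square field_simps)
  \<comment> \<open>Completing the square replaces the square root of A^2 - B by a linear
    expression.\<close>
  also have "\<dots> \<le> (A - B / (2 * A))\<^sup>2"
    using A by (simp add: power2_eq_square field_simps)
  finally have "cmod (1 + w / 2) \<le> A - B / (2 * A)"
    by (rule power2_le_imp_le) (use B in auto)
  moreover have "B / (2 * A) \<ge> (1 / 3 * (\<theta>\<^sup>2 / 12)) / 3"
    unfolding B_def using x A one_minus_cos_ge[OF t] by (intro frac_le mult_mono) auto
  ultimately have w1: "cmod (1 + w / 2) \<le> A - \<theta>\<^sup>2 / 108" by simp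
  have "(exp w - 1 - w - w\<^sup>2 / 2) + w * (1 + w / 2) = exp w - 1"
    by (simp add: power2_eq_square field_simps)
  then have "cmod (exp w - 1) \<le> cmod (exp w - 1 - w - w\<^sup>2 / 2) + cmod (w * (1 + w / 2))"
    using norm_triangle_ineq[of "exp w - 1 - w - w\<^sup>2 / 2" "w * (1 + w / 2)"] by (simp only:)
  also have "\<dots> \<le> (exp x - 1 - x - x\<^sup>2 / 2) + x * cmod (1 + w / 2)"
    using norm_exp_minus_quadratic_le[of w] unfolding norm_mult nw by simp
  also have "\<dots> \<le> (exp x - 1 - x - x\<^sup>2 / 2) + x * (A - \<theta>\<^sup>2 / 108)"
    using w1 x by (intro add_left_mono mult_left_mono) auto
  also have "\<dots> = exp x - 1 - x * \<theta>\<^sup>2 / 108"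
    by (simp add: A_def power2_eq_square field_simps)
  finally have "cmod (exp w - 1) \<le> exp x - 1 - x * \<theta>\<^sup>2 / 108" .
  then have "cmod (exp w - 1) / (exp x - 1) \<le> (exp x - 1 - x * \<theta>\<^sup>2 / 108) / (exp x - 1)"
    using exp_minus_one_pos by (intro divide_right_mono) auto
  also have "\<dots> = 1 - x * \<theta>\<^sup>2 / (108 * (exp x - 1))"
    using exp_minus_one_pos by (simp add: field_simps)
  also have "\<dots> \<le> 1 - (1 / 3) * \<theta>\<^sup>2 / (108 * 2)"
    using exp_minus_one_pos x by (intro diff_left_mono frac_le mult_mono mult_right_mono) auto
  also have "\<dots> \<le> exp (- (1 / 648) * \<theta>\<^sup>2)"
    using exp_ge_add_one_self[of "- (1 / 648) * \<theta>\<^sup>2"] by simp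
  finally show ?thesis
    using exp_minus_one_pos by (simp add: tpois_char_def w_def norm_divide flip: of_real_diff)
qed

text \<open>The characteristic function is e^w with w = x (cis \<theta> - 1), and |w| is bounded
  both by |\<theta>| and by 2; then e^|w| - 1 \<le> e^|w| |w|.\<close>

lemma norm_pois_char_minus_one_le:
  "cmod (pois_char x \<theta> - 1) \<le> exp 2 * \<bar>\<theta>\<bar>"
proof -
  define w where "w = of_real x * (cis \<theta> - 1)"
  have nw: "cmod w = x * cmod (cis \<theta> - 1)" using x by (simp add: w_def norm_mult)
  also have "\<dots> \<le> 1 * \<bar>\<theta>\<bar>" using x norm_cis_minus_one_le by (intro mult_mono) auto
  finally have w1: "cmod w \<le> \<bar>\<theta>\<bar>" by simp
  have "cmod (cis \<theta> - 1) \<le> 2" using norm_triangle_ineq4[of "cis \<theta>" 1] by simp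
  then have "x * cmod (cis \<theta> - 1) \<le> 1 * 2" using x by (intro mult_mono) auto
  then have w2: "cmod w \<le> 2" using nw by simp
  have "pois_char x \<theta> - 1 = exp w - 1"
    by (simp add: pois_char_def w_def algebra_simps exp_diff exp_of_real)
  also have "cmod \<dots> \<le> exp (cmod w) - 1" by (rule norm_exp_minus_one_le)
  also have "\<dots> = exp (cmod w) * (1 - exp (- cmod w))" by (simp add: algebra_simps flip: exp_add)
  also have "\<dots> \<le> exp 2 * \<bar>\<theta>\<bar>"
    using w1 w2 exp_ge_add_one_self[of "- cmod w"] by (intro mult_mono) (auto simp del: exp_ge_add_one_self)
  finally show ?thesis .
qed

lemma tpois_prob_nonneg: "tpois_prob x k \<ge> 0"
  using x exp_minus_one_pos by (auto simp: tpois_prob_def)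

lemma exp_moments:
  shows "(\<lambda>k. real k * (x ^ k / fact k)) sums (x * exp x)"
    and "(\<lambda>k. real k ^ 2 * (x ^ k / fact k)) sums ((x + x\<^sup>2) * exp x)"
proof -
  have e: "(\<lambda>k. x ^ k / fact k) sums exp x" by (rule exp_sums_divide)
  have s1: "real (Suc k) * (x ^ Suc k / fact (Suc k)) = x * (x ^ k / fact k)" for k
    by (simp add: field_simps del: of_nat_Suc)
  have "(\<lambda>k. real (Suc k) * (x ^ Suc k / fact (Suc k))) sums (x * exp x)"
    unfolding s1 by (rule sums_mult[OF e])
  from sums_Suc[OF this] show 1: "(\<lambda>k. real k * (x ^ k / fact k)) sums (x * exp x)" by simp
  have s2: "real (Suc k) ^ 2 * (x ^ Suc k / fact (Suc k)) = x * (real k * (x ^ k / fact k)) + x * (x ^ k / fact k)" for k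
  proof -
    have "real (Suc k) ^ 2 * (x ^ Suc k / fact (Suc k)) = real (Suc k) * (x * (x ^ k / fact k))"
      unfolding power2_eq_square s1[symmetric] by (simp only: mult.assoc)
    also have "\<dots> = x * (real k * (x ^ k / fact k)) + x * (x ^ k / fact k)"
      by (simp only: of_nat_Suc distrib_right distrib_left mult_1_left mult.left_commute add.commute)
    finally show ?thesis .
  qed
  have "(\<lambda>k. real (Suc k) ^ 2 * (x ^ Suc k / fact (Suc k))) sums (x * (x * exp x) + x * exp x)"
    unfolding s2 by (intro sums_add sums_mult 1 e)
  from sums_Suc[OF this] show "(\<lambda>k. real k ^ 2 * (x ^ k / fact k)) sums ((x + x\<^sup>2) * exp x)"
    by (simp add: algebra_simps power2_eq_square)
qed

text \<open>Every expectation below comes from an exponential series: drop the term at 0, which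
  truncation removes, and renormalise by e^x - 1.\<close>

lemma sums_tpois_prob:
  fixes f :: "nat \<Rightarrow> 'a :: {banach, real_normed_field}"
  assumes "(\<lambda>k. f k * of_real (x ^ k / fact k)) sums S"
  shows "(\<lambda>k. f k * of_real (tpois_prob x k)) sums ((S - f 0) / of_real (exp x - 1))"
proof -
  have "(\<lambda>k. f (Suc k) * of_real (x ^ Suc k / fact (Suc k))) sums (S - f 0)"
    using sums_split_initial_segment[OF assms, of 1] by simp
  from sums_divide[OF this, of "of_real (exp x - 1)"]
  have "(\<lambda>k. f (Suc k) * of_real (tpois_prob x (Suc k))) sums ((S - f 0) / of_real (exp x - 1))"
    by (simp add: tpois_prob_def of_real_diff del: fact_Suc power_Suc)
  from sums_Suc[OF this] show ?thesis by (simp add: tpois_prob_def)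
qed

text \<open>The exponential moment is included because it controls the third absolute central
  moment.\<close>

lemma tpois_prob_sums:
  "tpois_prob x sums 1" "(\<lambda>k. real k * tpois_prob x k) sums tpois_mean x" "(\<lambda>k. (real k)\<^sup>2 * tpois_prob x k) sums (tpois_mean x * (1 + x))"
  "(\<lambda>k. exp (real k) * tpois_prob x k) sums ((exp (exp 1 * x) - 1) / (exp x - 1))"
  "(\<lambda>k. cis \<theta> ^ k * of_real (tpois_prob x k)) sums tpois_char x \<theta>"
proof -
  show "tpois_prob x sums 1"
    using sums_tpois_prob[of "\<lambda>_. 1 :: real" "exp x"] exp_sums_divide[of x] exp_minus_one_pos(1) by simp
  show "(\<lambda>k. real k * tpois_prob x k) sums tpois_mean x"
    using sums_tpois_prob[of "\<lambda>k. real k"] exp_moments(1) by (simp add: tpois_mean_alt)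
  show "(\<lambda>k. (real k)\<^sup>2 * tpois_prob x k) sums (tpois_mean x * (1 + x))"
    using sums_tpois_prob[of "\<lambda>k. (real k)\<^sup>2"] exp_moments(2) by (simp add: tpois_mean_alt algebra_simps power2_eq_square)
  have "exp (real k) * of_real (x ^ k / fact k) = (exp 1 * x) ^ k / fact k" for k
    by (simp add: power_mult_distrib flip: exp_of_nat_mult)
  then show "(\<lambda>k. exp (real k) * tpois_prob x k) sums ((exp (exp 1 * x) - 1) / (exp x - 1))"
    using sums_tpois_prob[of "\<lambda>k. exp (real k)" "exp (exp 1 * x)"] exp_sums_divide[of "exp 1 * x"] by simp
  have "cis \<theta> ^ k * of_real (x ^ k / fact k) = (of_real x * cis \<theta>) ^ k / fact k" for k
    by (simp add: power_mult_distrib)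
  then show "(\<lambda>k. cis \<theta> ^ k * of_real (tpois_prob x k)) sums tpois_char x \<theta>"
    using sums_tpois_prob[of "\<lambda>k. cis \<theta> ^ k" "exp (of_real x * cis \<theta>)"] exp_sums_divide[of "of_real x * cis \<theta>"]
    by (simp add: tpois_char_def)
qed

text \<open>Taylor expansion under the expectation, after centring. With d = k - mean, |d|^3 / 3!
  \<le> e^|d| \<le> e^mean e^k, so the exponential moment bounds the error; mean \<le> 2 and e^x - 1
  \<ge> 1/3 give 3 e^(2 + e). Passing from 1 - z to e^(-z) costs z^2 \<le> \<theta>^4 \<le> 4
  |\<theta>|^3.\<close>

lemma tpois_char_taylor:
  assumes t: "\<bar>\<theta>\<bar> \<le> pi"
  shows "cmod (tpois_char x \<theta> * cis (- (tpois_mean x * \<theta>)) - of_real (exp (- (tpois_var x / 2) * \<theta>\<^sup>2)))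
    \<le> (3 * exp (2 + exp 1) + 4) * \<bar>\<theta>\<bar> ^ 3"
proof -
  let ?m = "tpois_mean x"
  let ?d = "\<lambda>k. (real k - ?m)"
  let ?T = "\<lambda>k. complex_of_real (1 - (?d k * \<theta>)\<^sup>2 / 2) + \<i> * of_real (?d k * \<theta>)"
  have S1: "(\<lambda>k. cis (?d k * \<theta>) * of_real (tpois_prob x k)) sums (tpois_char x \<theta> * cis (- (?m * \<theta>)))"
  proof -
    have "cis (?d k * \<theta>) * of_real (tpois_prob x k) = cis \<theta> ^ k * of_real (tpois_prob x k) * cis (- (?m * \<theta>))" for k
    proof -
      have "cis (?d k * \<theta>) = cis \<theta> ^ k * cis (- (?m * \<theta>))"
        by (simp add: Complex.DeMoivre cis_mult algebra_simps)
      then show ?thesis by (simp only: mult_ac)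
    qed
    then show ?thesis using sums_mult2[OF tpois_prob_sums(5)[of \<theta>], of "cis (- (?m * \<theta>))"] by (simp only:)
  qed
  have "(\<lambda>k. (real k)\<^sup>2 * tpois_prob x k - 2 * ?m * (real k * tpois_prob x k) + ?m\<^sup>2 * tpois_prob x k) sums
      (?m * (1 + x) - 2 * ?m * ?m + ?m\<^sup>2 * 1)"
    by (intro sums_add sums_diff sums_mult tpois_prob_sums)
  then have Sv: "(\<lambda>k. (?d k)\<^sup>2 * tpois_prob x k) sums tpois_var x"
    by (simp add: tpois_var_def algebra_simps power2_eq_square)
  have "(\<lambda>k. real k * tpois_prob x k - ?m * tpois_prob x k) sums (?m - ?m * 1)"
    by (intro sums_diff sums_mult tpois_prob_sums)
  then have Sm: "(\<lambda>k. ?d k * tpois_prob x k) sums 0" by (simp add: algebra_simps)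
  have "(\<lambda>k. complex_of_real (tpois_prob x k - (\<theta>\<^sup>2 / 2) * ((?d k)\<^sup>2 * tpois_prob x k)) + \<i> * of_real (\<theta> * (?d k * tpois_prob x k))) sums
     (of_real (1 - (\<theta>\<^sup>2 / 2) * tpois_var x) + \<i> * of_real (\<theta> * 0))"
    by (intro sums_add sums_mult sums_of_real sums_diff Sv Sm tpois_prob_sums)
  moreover have "?T k * of_real (tpois_prob x k) = complex_of_real (tpois_prob x k - (\<theta>\<^sup>2 / 2) * ((?d k)\<^sup>2 * tpois_prob x k)) + \<i> * of_real (\<theta> * (?d k * tpois_prob x k))" for k
    by (simp add: field_simps power2_eq_square)
  ultimately have S2: "(\<lambda>k. ?T k * of_real (tpois_prob x k)) sums of_real (1 - tpois_var x / 2 * \<theta>\<^sup>2)"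
    by (simp add: mult_ac)
  have S3: "(\<lambda>k. \<bar>\<theta>\<bar> ^ 3 * exp ?m * (exp (real k) * tpois_prob x k)) sums
      (\<bar>\<theta>\<bar> ^ 3 * exp ?m * ((exp (exp 1 * x) - 1) / (exp x - 1)))"
    by (intro sums_mult tpois_prob_sums)
  have "cmod (tpois_char x \<theta> * cis (- (?m * \<theta>)) - of_real (1 - tpois_var x / 2 * \<theta>\<^sup>2)) \<le>
      \<bar>\<theta>\<bar> ^ 3 * exp ?m * ((exp (exp 1 * x) - 1) / (exp x - 1))"
  proof (rule norm_sums_le[OF sums_diff[OF S1 S2] S3])
    fix k
    have "cmod (cis (?d k * \<theta>) - ?T k) \<le> \<bar>?d k * \<theta>\<bar> ^ 3 / 6"
      using norm_cis_minus_quadratic_le[of "?d k * \<theta>"] by (simp add: algebra_simps)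
    also have "\<dots> = \<bar>\<theta>\<bar> ^ 3 * (\<bar>?d k\<bar> ^ 3 / fact 3)"
      by (simp add: abs_mult power_mult_distrib fact_numeral)
    also have "\<bar>?d k\<bar> ^ 3 / fact 3 \<le> exp \<bar>?d k\<bar>"
      using sum_le_suminf[of "\<lambda>n. \<bar>?d k\<bar> ^ n / fact n" "{3}"] exp_sums_divide[of "\<bar>?d k\<bar>"]
      by (simp add: sums_iff)
    also have "exp \<bar>?d k\<bar> \<le> exp ?m * exp (real k)"
      using tpois_mean_bounds by (simp flip: exp_add)
    finally have "cmod (cis (?d k * \<theta>) - ?T k) \<le> \<bar>\<theta>\<bar> ^ 3 * (exp ?m * exp (real k))"
      by (simp add: mult_left_mono)
    then have "cmod (cis (?d k * \<theta>) - ?T k) * tpois_prob x k \<le> \<bar>\<theta>\<bar> ^ 3 * (exp ?m * exp (real k)) * tpois_prob x k"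
      by (intro mult_right_mono tpois_prob_nonneg)
    moreover have "cmod (cis (?d k * \<theta>) * of_real (tpois_prob x k) - ?T k * of_real (tpois_prob x k)) = cmod (cis (?d k * \<theta>) - ?T k) * tpois_prob x k"
      using tpois_prob_nonneg[of k] by (simp add: norm_mult flip: left_diff_distrib)
    ultimately show "cmod (cis (?d k * \<theta>) * of_real (tpois_prob x k) - ?T k * of_real (tpois_prob x k)) \<le> \<bar>\<theta>\<bar> ^ 3 * exp ?m * (exp (real k) * tpois_prob x k)"
      by (simp add: mult_ac)
  qed
  also have "\<dots> \<le> \<bar>\<theta>\<bar> ^ 3 * exp 2 * (exp (exp 1) / (1 / 3))"
  proof (intro mult_mono mult_left_mono frac_le)
    have "exp (exp 1 * x) \<le> exp (exp 1 :: real)" using x by simp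
    then show "exp (exp 1 * x) - 1 \<le> exp (exp 1 :: real)" by linarith
  qed (use tpois_mean_bounds x exp_minus_one_pos in auto)
  also have "\<dots> = 3 * exp (2 + exp 1) * \<bar>\<theta>\<bar> ^ 3" by (simp add: exp_add)
  finally have E1: "cmod (tpois_char x \<theta> * cis (- (?m * \<theta>)) - of_real (1 - tpois_var x / 2 * \<theta>\<^sup>2)) \<le> 3 * exp (2 + exp 1) * \<bar>\<theta>\<bar> ^ 3" .
  define z where "z = tpois_var x / 2 * \<theta>\<^sup>2"
  have z: "0 \<le> z" "z \<le> \<theta>\<^sup>2"
    using tpois_var_bounds mult_right_mono[of "tpois_var x / 2" 1 "\<theta>\<^sup>2"] by (auto simp: z_def)
  have "1 - z \<le> exp (- z)" using exp_ge_add_one_self[of "- z"] by simp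
  \<comment> \<open>Here (1 - z + z^2)(1 + z) = 1 + z^3 \<ge> 1 is compared with e^(-z) (1 + z)
    \<le> 1.\<close>
  moreover have "exp (- z) \<le> 1 - z + z\<^sup>2"
  proof -
    have "exp (- z) * (1 + z) \<le> exp (- z) * exp z" by (intro mult_left_mono exp_ge_add_one_self) auto
    then have "exp (- z) * (1 + z) \<le> 1" by (simp flip: exp_add)
    also have "1 \<le> (1 - z + z\<^sup>2) * (1 + z)" using z by (simp add: algebra_simps power2_eq_square)
    finally show ?thesis using z by simp
  qed
  ultimately have "\<bar>(1 - z) - exp (- z)\<bar> \<le> z\<^sup>2" by auto
  also have "\<dots> \<le> (\<theta>\<^sup>2)\<^sup>2" using z by (intro power_mono) auto
  also have "\<dots> = \<bar>\<theta>\<bar> * \<bar>\<theta>\<bar> ^ 3" by (simp add: power2_eq_square power3_eq_cube)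
  also have "\<dots> \<le> 4 * \<bar>\<theta>\<bar> ^ 3" using t pi_less_4 by (intro mult_right_mono) auto
  finally have "cmod (of_real (1 - z) - of_real (exp (- z))) \<le> 4 * \<bar>\<theta>\<bar> ^ 3"
    by (simp only: norm_of_real flip: of_real_diff)
  with E1 have "cmod ((tpois_char x \<theta> * cis (- (?m * \<theta>)) - of_real (1 - z)) + (of_real (1 - z) - of_real (exp (- z))))
      \<le> 3 * exp (2 + exp 1) * \<bar>\<theta>\<bar> ^ 3 + 4 * \<bar>\<theta>\<bar> ^ 3"
    unfolding z_def by (intro norm_triangle_le add_mono)
  then show ?thesis by (simp add: z_def algebra_simps)
qed

text \<open>Cauchy's formula at radius x. The factor 1 plays the part of \<psi> in
  \<open>local_limit_bound\<close>, so that \<open>Acoef\<close> and \<open>Bcoef\<close> share the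
  constant \<open>llt_C\<close>.\<close>

lemma Bcoef_integral:
  "Bcoef x s j = 1 / of_real (2 * pi) * integral {-pi..pi} (\<lambda>\<theta>. 1 * tpois_char x \<theta> ^ j * cis (- (real s * \<theta>)))"
proof -
  define D where "D = complex_of_real (exp x - 1)"
  have D: "D \<noteq> 0" using exp_minus_one_pos(1) by (simp only: D_def of_real_eq_0_iff)
  have "eval_fps ((fps_exp 1 - 1) ^ j) (of_real x * cis \<theta>) * cis (- (real s * \<theta>))
      = D ^ j * (1 * tpois_char x \<theta> ^ j * cis (- (real s * \<theta>)))" for \<theta>
    unfolding eval_fps_exp_minus_one_power tpois_char_def D_def[symmetric]
    using D by (simp add: power_divide)
  then have "fps_nth ((fps_exp 1 - 1) ^ j) s * of_real x ^ s =
      1 / of_real (2 * pi) * (D ^ j * integral {-pi..pi} (\<lambda>\<theta>. 1 * tpois_char x \<theta> ^ j * cis (- (real s * \<theta>))))"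
    using fps_nth_eq_integral[of x "(fps_exp 1 - 1) ^ j" s] x
    by (simp only: fps_conv_radius_exp_minus_one_power integral_mult_right)
  then show ?thesis
    unfolding Bcoef_def D_def[symmetric] using D by simp
qed

lemma Acoef_integral:
  "Acoef x r j = 1 / of_real (2 * pi) * integral {-pi..pi} (\<lambda>\<theta>. pois_char x \<theta> * tpois_char x \<theta> ^ j * cis (- (real r * \<theta>)))"
proof -
  define D where "D = complex_of_real (exp x - 1)"
  define W where "W = complex_of_real (exp x)"
  have D: "D \<noteq> 0" using exp_minus_one_pos(1) by (simp only: D_def of_real_eq_0_iff)
  have W: "W \<noteq> 0" by (simp add: W_def)
  have "eval_fps (fps_exp 1 * (fps_exp 1 - 1) ^ j) (of_real x * cis \<theta>) * cis (- (real r * \<theta>))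
      = (W * D ^ j) * (pois_char x \<theta> * tpois_char x \<theta> ^ j * cis (- (real r * \<theta>)))" for \<theta>
    unfolding eval_fps_exp_minus_one_power tpois_char_def pois_char_def D_def[symmetric] W_def[symmetric]
    using D W by (simp add: power_divide)
  then have "fps_nth (fps_exp 1 * (fps_exp 1 - 1) ^ j) r * of_real x ^ r =
      1 / of_real (2 * pi) * ((W * D ^ j) * integral {-pi..pi} (\<lambda>\<theta>. pois_char x \<theta> * tpois_char x \<theta> ^ j * cis (- (real r * \<theta>))))"
    using fps_nth_eq_integral[of x "fps_exp 1 * (fps_exp 1 - 1) ^ j" r] x
    by (simp only: fps_conv_radius_exp_minus_one_power integral_mult_right)
  then show ?thesis
    unfolding Acoef_def D_def[symmetric] W_def[symmetric] using D W by simp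
qed

lemma continuous_tpois_char_pois_char:
  "continuous_on S (tpois_char x)" "continuous_on S (pois_char x)"
proof -
  have nz: "complex_of_real (exp x - 1) \<noteq> 0" "complex_of_real (exp x) \<noteq> 0"
    using exp_minus_one_pos(1) by (simp_all only: of_real_eq_0_iff exp_not_eq_zero) auto
  show "continuous_on S (tpois_char x)" "continuous_on S (pois_char x)"
    unfolding tpois_char_def [abs_def] pois_char_def [abs_def] cis_conv_exp
    by (intro continuous_intros ballI nz)+
qed

lemma Acoef_local_limit:
  assumes "j \<ge> 1"
  shows "cmod (Acoef x r j - of_real (gdens (real j * tpois_var x) (real r - real j * tpois_mean x))) \<le> llt_C / real j"
  unfolding Acoef_integral llt_C_def
proof (rule local_limit_bound[OF _ _ _ _ continuous_tpois_char_pois_char norm_tpois_char_le tpois_char_taylor norm_pois_char_minus_one_le assms])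
  show "2 * (1 / 648) \<le> tpois_var x" using tpois_var_bounds(1) by linarith
qed (simp_all add: add_nonneg_nonneg)

lemma Bcoef_local_limit:
  assumes "j \<ge> 1"
  shows "cmod (Bcoef x s j - of_real (gdens (real j * tpois_var x) (real s - real j * tpois_mean x))) \<le> llt_C / real j"
  unfolding Bcoef_integral llt_C_def
proof (rule local_limit_bound[OF _ _ _ _ continuous_tpois_char_pois_char(1) continuous_on_const norm_tpois_char_le tpois_char_taylor _ assms])
  show "2 * (1 / 648) \<le> tpois_var x" using tpois_var_bounds(1) by linarith
qed (simp_all add: add_nonneg_nonneg)

text \<open>The quantity is a probability; analytically, the generating function has positive
  coefficients and is largest on its circle at the positive real point.\<close>

lemma norm_Acoef_le: "cmod (Acoef x r j) \<le> 1"
proof -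
  have "cmod (fps_nth (fps_exp 1 * (fps_exp 1 - 1) ^ j) r) * x ^ r \<le> exp x * (exp x - 1) ^ j"
  proof (rule fps_nth_bound[OF _ fps_conv_radius_exp_minus_one_power(2)])
    fix \<theta> :: real
    define w where "w = of_real x * cis \<theta>"
    have n: "cmod w = x" using x by (simp add: w_def norm_mult)
    show "cmod (eval_fps (fps_exp 1 * (fps_exp 1 - 1) ^ j) (of_real x * cis \<theta>)) \<le> exp x * (exp x - 1) ^ j"
      unfolding eval_fps_exp_minus_one_power norm_mult norm_power w_def[symmetric]
      using norm_exp_minus_one_le[of w] norm_exp[of w] n
      by (intro mult_mono power_mono) auto
  qed (use x in simp)
  then show ?thesis
    unfolding Acoef_def norm_mult norm_divide norm_power norm_of_real
    using x exp_minus_one_pos(1) by (simp only: divide_le_eq_1_pos abs_of_pos abs_exp_cancel mult_pos_pos zero_less_power exp_gt_zero)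
qed

text \<open>Cauchy's estimate on the circle of radius $e x$.\<close>

lemma norm_Bcoef_le: "cmod (Bcoef x s j) \<le> exp (4 * real j - real s)"
proof -
  have "cmod (fps_nth ((fps_exp 1 - 1) ^ j) s) * (exp 1 * x) ^ s \<le> (exp (exp 1 * x) - 1) ^ j"
  proof (rule fps_nth_bound[OF _ fps_conv_radius_exp_minus_one_power(1)])
    fix \<theta> :: real
    define w where "w = of_real (exp 1 * x) * cis \<theta>"
    have n: "cmod w = exp 1 * x" using x by (simp add: w_def norm_mult)
    show "cmod (eval_fps ((fps_exp 1 - 1) ^ j) (of_real (exp 1 * x) * cis \<theta>)) \<le> (exp (exp 1 * x) - 1) ^ j"
      unfolding eval_fps_exp_minus_one_power norm_power w_def[symmetric]
      using norm_exp_minus_one_le[of w] n by (intro power_mono) auto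
  qed (use x in simp)
  also have "\<dots> \<le> (exp 4 * (exp x - 1)) ^ j"
  proof (rule power_mono)
    have "exp 1 * x \<le> 68 / 25 * 1"
      using x e_less_272 by (intro mult_mono) auto
    then have "exp (exp 1 * x) \<le> exp (68 / 25)" by simp
    also have "\<dots> \<le> exp 4 * (1 / 3)"
    proof -
      \<comment> \<open>With e < 68/25 the exponents add to 4, and the factor 3 pays for e^x - 1
        \<ge> 1/3.\<close>
      have "3 \<le> exp (32 / 25 :: real)"
        using exp_lower_Taylor_quadratic[of "32 / 25"] by (simp add: power2_eq_square)
      then have "exp (68 / 25) * 3 \<le> exp (68 / 25) * exp (32 / 25 :: real)" by simp
      also have "exp (68 / 25) * exp (32 / 25) = exp (4 :: real)" unfolding exp_add[symmetric] by simp
      finally show ?thesis by simp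
    qed
    also have "\<dots> \<le> exp 4 * (exp x - 1)"
      using x exp_minus_one_pos(2) by (intro mult_left_mono) auto
    finally show "exp (exp 1 * x) - 1 \<le> exp 4 * (exp x - 1)" by linarith
  qed (use x in simp)
  finally have "cmod (fps_nth ((fps_exp 1 - 1) ^ j) s) * x ^ s * exp (real s) \<le> exp (4 * real j) * (exp x - 1) ^ j"
    using exp_of_nat_mult[of s "1 :: real"] exp_of_nat_mult[of j "4 :: real"]
    by (simp only: power_mult_distrib mult_ac mult_1_right mult_1_left)
  moreover have "\<bar>exp x - 1\<bar> ^ j > 0" "\<bar>x\<bar> = x" "\<bar>exp x - 1\<bar> = exp x - 1"
    using x exp_minus_one_pos(1) by auto
  ultimately show ?thesis
    unfolding Bcoef_def norm_mult norm_divide norm_power norm_of_real exp_diff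
    by (simp only: divide_le_eq le_divide_eq exp_gt_zero if_True times_divide_eq_left)
qed

end

section \<open>Gaussian sums\<close>

text \<open>Mean value inequality. The derivative is bounded at an intermediate \<tau>, and w^2
  \<le> 2 \<tau>^2 + 2 moves the bound to the endpoint w, so that it can be integrated in w.\<close>

lemma gauss_step:
  fixes \<alpha> u w :: real
  assumes \<alpha>: "\<alpha> > 0" and uw: "\<bar>u - w\<bar> \<le> 1"
  shows "\<bar>exp (- \<alpha> * u\<^sup>2) - exp (- \<alpha> * w\<^sup>2)\<bar> \<le> 2 * sqrt \<alpha> * exp (\<alpha> / 2) * exp (- (\<alpha> / 4) * w\<^sup>2)"
proof -
  let ?B = "2 * sqrt \<alpha> * exp (\<alpha> / 2) * exp (- (\<alpha> / 4) * w\<^sup>2)"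
  have "norm (exp (- \<alpha> * u\<^sup>2) - exp (- \<alpha> * w\<^sup>2)) \<le> ?B * norm (u - w)"
  proof (rule field_differentiable_bound[where S = "closed_segment u w" and f' = "\<lambda>\<tau>. exp (- \<alpha> * \<tau>\<^sup>2) * (- \<alpha> * (2 * \<tau>))"])
    fix \<tau> assume t: "\<tau> \<in> closed_segment u w"
    show "((\<lambda>\<tau>. exp (- \<alpha> * \<tau>\<^sup>2)) has_field_derivative exp (- \<alpha> * \<tau>\<^sup>2) * (- \<alpha> * (2 * \<tau>))) (at \<tau> within closed_segment u w)"
      by (auto intro!: derivative_eq_intros)
    have "\<bar>\<tau> - w\<bar> \<le> 1"
      using segment_bound(2)[OF t] uw by (simp add: abs_minus_commute)
    then have "(\<tau> - w)\<^sup>2 \<le> 1" by (simp add: abs_square_le_1)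
    moreover have "w\<^sup>2 \<le> 2 * \<tau>\<^sup>2 + 2 * (\<tau> - w)\<^sup>2"
      using zero_le_power2[of "2 * \<tau> - w"] by (simp add: power2_eq_square algebra_simps)
    ultimately have "\<alpha> * (w\<^sup>2 / 2 - 1) \<le> \<alpha> * \<tau>\<^sup>2" using \<alpha> by (intro mult_left_mono) auto
    then have e: "exp (- (\<alpha> / 2) * \<tau>\<^sup>2) \<le> exp (\<alpha> / 2) * exp (- (\<alpha> / 4) * w\<^sup>2)"
      by (simp add: algebra_simps flip: exp_add)
    have "norm (exp (- \<alpha> * \<tau>\<^sup>2) * (- \<alpha> * (2 * \<tau>))) = 2 * \<alpha> * (\<bar>\<tau>\<bar> * exp (- \<alpha> * \<tau>\<^sup>2))"
      using \<alpha> by (simp add: abs_mult)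
    also have "\<dots> \<le> 2 * \<alpha> * (exp (- (\<alpha> / 2) * \<tau>\<^sup>2) / sqrt \<alpha>)"
      using \<alpha> by (intro mult_left_mono abs_mult_exp_neg_square_le) auto
    also have "\<dots> = 2 * sqrt \<alpha> * exp (- (\<alpha> / 2) * \<tau>\<^sup>2)"
    proof -
      have "\<alpha> / sqrt \<alpha> = sqrt \<alpha>" using \<alpha> by (simp add: real_div_sqrt)
      moreover have "2 * \<alpha> * (X / sqrt \<alpha>) = 2 * (\<alpha> / sqrt \<alpha>) * X" for X by simp
      ultimately show ?thesis by (simp only:)
    qed
    also have "\<dots> \<le> 2 * sqrt \<alpha> * (exp (\<alpha> / 2) * exp (- (\<alpha> / 4) * w\<^sup>2))"
      using e \<alpha> by (intro mult_left_mono) auto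
    finally show "norm (exp (- \<alpha> * \<tau>\<^sup>2) * (- \<alpha> * (2 * \<tau>))) \<le> ?B" by (simp add: mult.assoc)
  qed auto
  also have "\<dots> \<le> ?B * 1" using uw \<alpha> by (intro mult_left_mono) auto
  finally show ?thesis by simp
qed

text \<open>Writing a finite sum as the integral of a step function lets sums and Gaussian integrals
  be compared integrand by integrand.\<close>

lemma has_bochner_integral_step:
  fixes f :: "nat \<Rightarrow> real"
  assumes "finite J"
  shows "has_bochner_integral lborel (\<lambda>t::real. if t \<ge> 0 \<and> nat \<lfloor>t\<rfloor> \<in> J then f (nat \<lfloor>t\<rfloor>) else 0) (\<Sum>j\<in>J. f j)"
proof -
  have "has_bochner_integral lborel (\<lambda>t. \<Sum>j\<in>J. indicator {real j..<real j + 1} t *\<^sub>R f j) (\<Sum>j\<in>J. measure lborel {real j..<real j + 1} *\<^sub>R f j)"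
    by (intro has_bochner_integral_sum has_bochner_integral_indicator) auto
  moreover have "(\<Sum>j\<in>J. indicator {real j..<real j + 1} t *\<^sub>R f j) = (if t \<ge> 0 \<and> nat \<lfloor>t\<rfloor> \<in> J then f (nat \<lfloor>t\<rfloor>) else 0)" for t
  proof -
    have "indicator {real j..<real j + 1} t = (if t \<ge> 0 \<and> j = nat \<lfloor>t\<rfloor> then 1 else (0::real))" for j
    proof (cases "t \<ge> 0")
      case True
      then have "t \<in> {real j..<real j + 1} \<longleftrightarrow> \<lfloor>t\<rfloor> = int j" by (auto simp: floor_eq_iff)
      then show ?thesis using True by (auto simp: indicator_def)
    qed (auto simp: indicator_def)
    then have "(\<Sum>j\<in>J. indicator {real j..<real j + 1} t *\<^sub>R f j) = (\<Sum>j\<in>J. if j = nat \<lfloor>t\<rfloor> then if t \<ge> 0 then f j else 0 else 0)"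
      by (intro sum.cong) auto
    also have "\<dots> = (if t \<ge> 0 \<and> nat \<lfloor>t\<rfloor> \<in> J then f (nat \<lfloor>t\<rfloor>) else 0)"
      using assms by (simp add: sum.delta)
    finally show ?thesis .
  qed
  ultimately show ?thesis by simp
qed

lemma floor_gauss_step:
  fixes \<alpha> n t :: real
  assumes "\<alpha> > 0" "t \<ge> 0"
  shows "\<bar>exp (- \<alpha> * (real (nat \<lfloor>t\<rfloor>) - n)\<^sup>2) - exp (- \<alpha> * (t - n)\<^sup>2)\<bar>
    \<le> 2 * sqrt \<alpha> * exp (\<alpha> / 2) * exp (- (\<alpha> / 4) * (t - n)\<^sup>2)"
proof (rule gauss_step)
  have "real (nat \<lfloor>t\<rfloor>) = of_int \<lfloor>t\<rfloor>" using assms by simp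
  then show "\<bar>real (nat \<lfloor>t\<rfloor>) - n - (t - n)\<bar> \<le> 1" by linarith
qed fact

text \<open>The total error of the Riemann sum stays bounded as \<alpha> tends to 0, whereas the
  Gaussian integral itself grows like \<alpha>^(-1/2).\<close>

lemma has_bochner_integral_gauss_step:
  fixes \<alpha> n :: real
  assumes "\<alpha> > 0"
  shows "has_bochner_integral lborel (\<lambda>t. 2 * sqrt \<alpha> * exp (\<alpha> / 2) * exp (- (\<alpha> / 4) * (t - n)\<^sup>2)) (4 * sqrt pi * exp (\<alpha> / 2))"
proof -
  have "has_bochner_integral lborel (\<lambda>t. 2 * sqrt \<alpha> * exp (\<alpha> / 2) * exp (- (\<alpha> / 4) * (t - n)\<^sup>2))
      (2 * sqrt \<alpha> * exp (\<alpha> / 2) * sqrt (pi / (\<alpha> / 4)))"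
    using assms by (intro has_bochner_integral_mult_right has_bochner_integral_gauss) auto
  moreover have "sqrt \<alpha> * sqrt (pi / (\<alpha> / 4)) = 2 * sqrt pi"
  proof -
    have "sqrt \<alpha> * sqrt (pi / (\<alpha> / 4)) = sqrt (2\<^sup>2 * pi)"
      using assms by (simp flip: real_sqrt_mult)
    then show ?thesis by (simp only: real_sqrt_mult real_sqrt_abs abs_numeral)
  qed
  then have "2 * sqrt \<alpha> * exp (\<alpha> / 2) * sqrt (pi / (\<alpha> / 4)) = 4 * sqrt pi * exp (\<alpha> / 2)"
    by (simp add: mult_ac)
  ultimately show ?thesis by (simp only:)
qed

lemma gauss_sum_le:
  fixes \<alpha> n :: real
  assumes \<alpha>: "\<alpha> > 0" and J: "finite J"
  shows "(\<Sum>j\<in>J. exp (- \<alpha> * (real j - n)\<^sup>2)) \<le> sqrt (pi / \<alpha>) + 4 * sqrt pi * exp (\<alpha> / 2)"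
proof -
  note h = has_bochner_integral_step[OF J, of "\<lambda>j. exp (- \<alpha> * (real j - n)\<^sup>2)"]
  note g = has_bochner_integral_add[OF has_bochner_integral_gauss[OF \<alpha>, of n] has_bochner_integral_gauss_step[OF \<alpha>, of n]]
  show ?thesis
    unfolding has_bochner_integral_integral_eq[OF h, symmetric] has_bochner_integral_integral_eq[OF g, symmetric]
  proof (rule integral_mono[OF integrable.intros[OF h] integrable.intros[OF g]])
    fix t :: real
    show "(if t \<ge> 0 \<and> nat \<lfloor>t\<rfloor> \<in> J then exp (- \<alpha> * (real (nat \<lfloor>t\<rfloor>) - n)\<^sup>2) else 0)
        \<le> exp (- \<alpha> * (t - n)\<^sup>2) + 2 * sqrt \<alpha> * exp (\<alpha> / 2) * exp (- (\<alpha> / 4) * (t - n)\<^sup>2)"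
    proof (cases "t \<ge> 0 \<and> nat \<lfloor>t\<rfloor> \<in> J")
      case True
      then show ?thesis using floor_gauss_step[OF \<alpha>, of t n] by auto
    next
      case False
      have "0 \<le> exp (- \<alpha> * (t - n)\<^sup>2) + 2 * sqrt \<alpha> * exp (\<alpha> / 2) * exp (- (\<alpha> / 4) * (t - n)\<^sup>2)"
        using \<alpha> by (intro add_nonneg_nonneg mult_nonneg_nonneg) auto
      with False show ?thesis by (simp only: if_False)
    qed
  qed
qed

text \<open>To the Riemann sum error comes the Gaussian mass outside [a, b + 1), the support of the
  step function. There |t - n| / R \<ge> 1 may be inserted, and
  \<open>abs_mult_exp_neg_square_le\<close> makes the result integrable with a gain of 1/R.\<close>

lemma gauss_sum_approx:
  fixes \<alpha> n R :: real
  assumes \<alpha>: "\<alpha> > 0" and R: "R > 0"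
    and lo: "\<And>t. t < real a \<Longrightarrow> R \<le> \<bar>t - n\<bar>" and hi: "\<And>t. real b + 1 \<le> t \<Longrightarrow> R \<le> \<bar>t - n\<bar>"
  shows "\<bar>(\<Sum>j=a..b. exp (- \<alpha> * (real j - n)\<^sup>2)) - sqrt (pi / \<alpha>)\<bar> \<le> 4 * sqrt pi * exp (\<alpha> / 2) + sqrt (2 * pi) / (R * \<alpha>)"
proof -
  let ?h = "\<lambda>t. if t \<ge> 0 \<and> nat \<lfloor>t\<rfloor> \<in> {a..b} then exp (- \<alpha> * (real (nat \<lfloor>t\<rfloor>) - n)\<^sup>2) else 0"
  let ?g = "\<lambda>t. exp (- \<alpha> * (t - n)\<^sup>2)"
  let ?D = "\<lambda>t. 2 * sqrt \<alpha> * exp (\<alpha> / 2) * exp (- (\<alpha> / 4) * (t - n)\<^sup>2)"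
  let ?T = "\<lambda>t. exp (- (\<alpha> / 2) * (t - n)\<^sup>2) / (sqrt \<alpha> * R)"
  have h: "has_bochner_integral lborel (\<lambda>t. ?h t - ?g t) ((\<Sum>j=a..b. exp (- \<alpha> * (real j - n)\<^sup>2)) - sqrt (pi / \<alpha>))"
    by (intro has_bochner_integral_diff has_bochner_integral_step has_bochner_integral_gauss \<alpha>) auto
  have T: "has_bochner_integral lborel ?T (sqrt (pi / (\<alpha> / 2)) / (sqrt \<alpha> * R))"
    using \<alpha> by (intro has_bochner_integral_divide has_bochner_integral_gauss) auto
  have Te: "sqrt (pi / (\<alpha> / 2)) / (sqrt \<alpha> * R) = sqrt (2 * pi) / (R * \<alpha>)"
  proof -
    have "sqrt (pi / (\<alpha> / 2)) / sqrt \<alpha> = sqrt (2 * pi / \<alpha>\<^sup>2)"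
      using \<alpha> by (simp add: power2_eq_square mult.commute flip: real_sqrt_divide)
    also have "\<dots> = sqrt (2 * pi) / \<alpha>" using \<alpha> by (simp only: real_sqrt_divide real_sqrt_abs abs_of_pos)
    finally show ?thesis using \<alpha> R by (simp add: field_simps)
  qed
  have DT: "has_bochner_integral lborel (\<lambda>t. ?D t + ?T t) (4 * sqrt pi * exp (\<alpha> / 2) + sqrt (2 * pi) / (R * \<alpha>))"
    unfolding Te[symmetric] by (intro has_bochner_integral_add has_bochner_integral_gauss_step \<alpha> T)
  have pos: "?D t \<ge> 0" "?T t \<ge> 0" for t using \<alpha> R by auto
  have bound: "\<bar>?h t - ?g t\<bar> \<le> ?D t + ?T t" for t
  proof (cases "t \<ge> 0 \<and> nat \<lfloor>t\<rfloor> \<in> {a..b}")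
    case True
    then show ?thesis using floor_gauss_step[OF \<alpha>, of t n] pos[of t] by simp
  next
    case False
    have "R \<le> \<bar>t - n\<bar>"
    proof (cases "t < real a")
      case F: False
      then have "t \<ge> 0" by (meson of_nat_0_le_iff order_trans not_less)
      then have "nat \<lfloor>t\<rfloor> \<notin> {a..b}" using False by simp
      moreover have "a \<le> nat \<lfloor>t\<rfloor>" using F \<open>t \<ge> 0\<close> by (simp add: le_nat_floor)
      ultimately have "b < nat \<lfloor>t\<rfloor>" by simp
      then have "real b + 1 \<le> t" using \<open>t \<ge> 0\<close> by linarith
      then show ?thesis by (rule hi)
    qed (rule lo)
    then have "?g t * R \<le> ?g t * \<bar>t - n\<bar>" by (intro mult_left_mono) auto
    also have "\<dots> \<le> exp (- (\<alpha> / 2) * (t - n)\<^sup>2) / sqrt \<alpha>"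
      using abs_mult_exp_neg_square_le[OF \<alpha>, of "t - n"] by (simp add: mult.commute)
    finally have "?g t \<le> ?T t" using R \<alpha> by (simp add: field_simps)
    then show ?thesis using False pos[of t] by (simp only: if_False) simp
  qed
  have "\<bar>(\<Sum>j=a..b. exp (- \<alpha> * (real j - n)\<^sup>2)) - sqrt (pi / \<alpha>)\<bar> = norm (\<integral>t. ?h t - ?g t \<partial>lborel)"
    using has_bochner_integral_integral_eq[OF h] by simp
  also have "\<dots> \<le> (\<integral>t. ?D t + ?T t \<partial>lborel)"
    using bound by (intro Bochner_Integration.integral_norm_bound_integral integrable.intros[OF h] integrable.intros[OF DT]) auto
  also have "\<dots> = 4 * sqrt pi * exp (\<alpha> / 2) + sqrt (2 * pi) / (R * \<alpha>)"
    by (rule has_bochner_integral_integral_eq[OF DT])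
  finally show ?thesis .
qed

definition gauss_sum_const :: "real \<Rightarrow> real" where "gauss_sum_const a = sqrt (pi / a) + 4 * sqrt pi * exp (a / 2)"

lemma gauss_sum_const_nonneg: "a > 0 \<Longrightarrow> gauss_sum_const a \<ge> 0"
  by (simp add: gauss_sum_const_def)

lemma gauss_sum_scaled_le:
  fixes a n :: real
  assumes a: "a > 0" and n: "n \<ge> 1" and J: "finite J"
  shows "(\<Sum>j\<in>J. exp (- (a / n) * (real j - n)\<^sup>2)) \<le> gauss_sum_const a * sqrt n"
proof -
  have "(\<Sum>j\<in>J. exp (- (a / n) * (real j - n)\<^sup>2)) \<le> sqrt (pi / (a / n)) + 4 * sqrt pi * exp (a / n / 2)"
    using a n by (intro gauss_sum_le J) auto
  also have "sqrt (pi / (a / n)) = sqrt (pi / a) * sqrt n" by (simp flip: real_sqrt_mult)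
  also have "4 * sqrt pi * exp (a / n / 2) \<le> 4 * sqrt pi * exp (a / 2) * sqrt n"
  proof -
    have "a / n \<le> a / 1" using a n by (intro divide_left_mono) auto
    then have "exp (a / n / 2) \<le> exp (a / 2)" by simp
    then have "4 * sqrt pi * exp (a / n / 2) * 1 \<le> 4 * sqrt pi * exp (a / 2) * sqrt n"
      using n by (intro mult_mono) auto
    then show ?thesis by simp
  qed
  finally show ?thesis by (simp add: gauss_sum_const_def algebra_simps)
qed

text \<open>This freezes the variance, replacing j by n. The derivative of e^(-k/\<tau>) / \<tau> is
  e^(-w) (w - 1) / \<tau>^2 with w = k/\<tau>, at most 2 e^(-w/2) / \<tau>^2. The factor |t - n|
  from the mean value inequality costs only sqrt n, so about sqrt n relevant indices with error
  n^(-3/2) sum to O(1/n).\<close>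

lemma exp_neg_inverse_divide_diff_le:
  fixes n t \<kappa> :: real
  assumes n: "n > 0" and t: "n / 8 \<le> t" "t \<le> 8 * n" and k: "\<kappa> \<ge> 1"
  shows "\<bar>exp (- (\<kappa> * (t - n)\<^sup>2) / (2 * t)) / t - exp (- (\<kappa> * (t - n)\<^sup>2) / (2 * n)) / n\<bar>
    \<le> 128 * sqrt 32 / n powr (3 / 2) * exp (- ((1 / 64) / n) * (t - n)\<^sup>2)"
proof -
  define u where "u = t - n"
  define k2 where "k2 = \<kappa> * u\<^sup>2 / 2"
  let ?f = "\<lambda>\<tau>. exp (- k2 / \<tau>) / \<tau>"
  let ?B = "128 / n\<^sup>2 * exp (- ((1 / 32) / n) * u\<^sup>2)"
  have k2: "k2 \<ge> u\<^sup>2 / 2" using k mult_right_mono[of 1 \<kappa> "u\<^sup>2"] by (simp add: k2_def)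
  have k20: "k2 \<ge> 0" using k2 zero_le_power2[of u] by linarith
  have "norm (?f t - ?f n) \<le> ?B * norm (t - n)"
  proof (rule field_differentiable_bound[where S = "{n / 8..8 * n}" and f' = "\<lambda>\<tau>. exp (- k2 / \<tau>) * (k2 / \<tau> - 1) / \<tau>\<^sup>2"])
    fix \<tau> assume T: "\<tau> \<in> {n / 8..8 * n}"
    then have \<tau>: "\<tau> > 0" "n / 8 \<le> \<tau>" "\<tau> \<le> 8 * n" using n by auto
    show "(?f has_field_derivative exp (- k2 / \<tau>) * (k2 / \<tau> - 1) / \<tau>\<^sup>2) (at \<tau> within {n / 8..8 * n})"
      using \<tau> by (auto intro!: derivative_eq_intros simp: field_simps power2_eq_square)
    define w where "w = k2 / \<tau>"
    have w: "w \<ge> 0" using k20 \<tau> by (simp add: w_def)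
    have "\<bar>w - 1\<bar> \<le> 2 * (1 + w / 2)" using w by auto
    also have "\<dots> \<le> 2 * exp (w / 2)" by (intro mult_left_mono exp_ge_add_one_self) auto
    finally have "exp (- w) * \<bar>w - 1\<bar> \<le> exp (- w) * (2 * exp (w / 2))" by (intro mult_left_mono) auto
    also have "\<dots> = 2 * exp (- (w / 2))" by (simp flip: exp_add)
    also have "\<dots> \<le> 2 * exp (- ((1 / 32) / n) * u\<^sup>2)"
    proof -
      have "u\<^sup>2 / 2 / (8 * n) \<le> k2 / \<tau>"
        using k2 k20 \<tau> n by (intro frac_le) auto
      then show ?thesis by (simp add: w_def)
    qed
    finally have 1: "exp (- w) * \<bar>w - 1\<bar> \<le> 2 * exp (- ((1 / 32) / n) * u\<^sup>2)" .
    have "(n / 8)\<^sup>2 \<le> \<tau>\<^sup>2" using \<tau> n by (intro power_mono) auto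
    then have "exp (- w) * \<bar>w - 1\<bar> / \<tau>\<^sup>2 \<le> 2 * exp (- ((1 / 32) / n) * u\<^sup>2) / (n / 8)\<^sup>2"
      using 1 n by (intro frac_le) auto
    then show "norm (exp (- k2 / \<tau>) * (k2 / \<tau> - 1) / \<tau>\<^sup>2) \<le> ?B"
      by (simp add: abs_mult w_def power_divide)
  qed (use n t in auto)
  then have "\<bar>?f t - ?f n\<bar> \<le> 128 / n\<^sup>2 * (\<bar>u\<bar> * exp (- ((1 / 32) / n) * u\<^sup>2))"
    by (simp add: u_def mult_ac)
  also have "\<dots> \<le> 128 / n\<^sup>2 * (exp (- ((1 / 32) / n / 2) * u\<^sup>2) / sqrt ((1 / 32) / n))"
    using n by (intro mult_left_mono abs_mult_exp_neg_square_le) auto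
  also have "\<dots> = 128 * sqrt 32 / n powr (3 / 2) * exp (- ((1 / 64) / n) * u\<^sup>2)"
  proof -
    have "n\<^sup>2 = n powr 2" using n by (simp add: powr_numeral)
    also have "\<dots> = n powr (3 / 2) * n powr (1 / 2)"
      using powr_add[of n "3 / 2" "1 / 2"] by simp
    finally have "n\<^sup>2 = n powr (3 / 2) * n powr (1 / 2)" .
    then have "n\<^sup>2 = n powr (3 / 2) * sqrt n" using n by (simp add: powr_half_sqrt)
    then show ?thesis using n by (simp add: real_sqrt_divide real_sqrt_mult field_simps)
  qed
  finally show ?thesis by (simp add: k2_def u_def)
qed

section \<open>The sum over the number of summands\<close>

lemma gdens_nonneg: "w \<ge> 0 \<Longrightarrow> gdens w t \<ge> 0"
  by (simp add: gdens_def)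

text \<open>On the window the variance t v lies between n/360 and 16 n: the lower bound gives the
  height 8 / sqrt n, the upper one and \<mu> \<ge> 1 the decay rate 1 / (32 n).\<close>

lemma gdens_le:
  fixes n t \<mu> v :: real
  assumes n: "n > 0" and t: "n / 8 \<le> t" "t \<le> 8 * n" and \<mu>: "1 \<le> \<mu>" and v: "1 / 45 \<le> v" "v \<le> 2"
  shows "gdens (t * v) (n * \<mu> - t * \<mu>) \<le> 8 / sqrt n * exp (- ((1 / 32) / n) * (t - n)\<^sup>2)"
proof -
  have tp: "t > 0" using n t by linarith
  have "(n / 8) * (1 / 45) \<le> t * v" using n t v by (intro mult_mono) auto
  then have "3 * (n / 360) \<le> pi * (t * v)" using n pi_gt3 by (intro mult_mono) auto
  then have "(sqrt n / 8)\<^sup>2 \<le> 2 * pi * (t * v)" using n by (simp add: power_divide)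
  then have sq: "sqrt n / 8 \<le> sqrt (2 * pi * (t * v))" by (rule real_le_rsqrt)
  have "(t - n)\<^sup>2 / (32 * n) \<le> (n * \<mu> - t * \<mu>)\<^sup>2 / (2 * (t * v))"
  proof (rule frac_le)
    have "(n * \<mu> - t * \<mu>)\<^sup>2 = (t - n)\<^sup>2 * \<mu>\<^sup>2" by (simp add: power2_eq_square algebra_simps)
    moreover have "1\<^sup>2 \<le> \<mu>\<^sup>2" using \<mu> by (intro power_mono) auto
    then have "(t - n)\<^sup>2 * 1 \<le> (t - n)\<^sup>2 * \<mu>\<^sup>2" by (intro mult_left_mono) auto
    ultimately show "(t - n)\<^sup>2 \<le> (n * \<mu> - t * \<mu>)\<^sup>2" by simp
    have "t * v \<le> 8 * n * 2" using n t v tp by (intro mult_mono) auto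
    then show "2 * (t * v) \<le> 32 * n" by simp
  qed (use tp v in auto)
  then have "exp (- (n * \<mu> - t * \<mu>)\<^sup>2 / (2 * (t * v))) \<le> exp (- ((1 / 32) / n) * (t - n)\<^sup>2)" by simp
  then have "gdens (t * v) (n * \<mu> - t * \<mu>) \<le> exp (- ((1 / 32) / n) * (t - n)\<^sup>2) / (sqrt n / 8)"
    unfolding gdens_def using sq n by (intro frac_le) auto
  then show ?thesis by (simp add: mult.commute)
qed

text \<open>In order: the product of the two local errors, the mixed terms, the freezing of the
  variance, and the passage from the Gaussian sum to its integral. The number 90 is 360/4, with 360
  the bound on \<kappa>.\<close>

definition renewal_const :: "real \<Rightarrow> real" where
  "renewal_const C = 512 * C\<^sup>2 + 128 * C * gauss_sum_const (1 / 32) + 1024 * sqrt 32 * gauss_sum_const (1 / 64)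
     + 8 * (4 * sqrt pi * exp 90 + 8 * sqrt (2 * pi))"

text \<open>On the window 1/j \<le> 8/n, so both local errors are O(1/n). Since (r, s) is n times
  the mean vector, both Gaussians are centred at j = n, and their product is again a Gaussian in j -
  n, with rate \<kappa> / (2 j). Its integral yields the combination of means and variances in the
  main term.\<close>

lemma renewal_sum_bound:
  fixes A B :: "nat \<Rightarrow> complex" and n \<mu>X \<mu>Y vX vY C :: real
  assumes n: "n \<ge> 4" and \<mu>X: "1 \<le> \<mu>X" "\<mu>X \<le> 2" and \<mu>Y: "1 \<le> \<mu>Y" "\<mu>Y \<le> 2"
    and vX: "1 / 45 \<le> vX" "vX \<le> 2" and vY: "1 / 45 \<le> vY" "vY \<le> 2" and C: "C \<ge> 0"
    and A: "\<And>j. j \<ge> 1 \<Longrightarrow> cmod (A j - of_real (gdens (real j * vX) (n * \<mu>X - real j * \<mu>X))) \<le> C / real j"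
    and B: "\<And>j. j \<ge> 1 \<Longrightarrow> cmod (B j - of_real (gdens (real j * vY) (n * \<mu>Y - real j * \<mu>Y))) \<le> C / real j"
  shows "cmod ((\<Sum>j=nat \<lceil>n / 8\<rceil>..nat \<lfloor>8 * n\<rfloor>. A j * B j)
      - of_real (1 / sqrt (2 * pi * n * (\<mu>X\<^sup>2 * vY + \<mu>Y\<^sup>2 * vX)))) \<le> renewal_const C / n"
proof -
  define J where "J = {nat \<lceil>n / 8\<rceil>..nat \<lfloor>8 * n\<rfloor>}"
  define gA where "gA j = gdens (real j * vX) (n * \<mu>X - real j * \<mu>X)" for j
  define gB where "gB j = gdens (real j * vY) (n * \<mu>Y - real j * \<mu>Y)" for j
  define e where "e j = exp (- ((1 / 32) / n) * (real j - n)\<^sup>2)" for j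
  define \<kappa> where "\<kappa> = \<mu>X\<^sup>2 / vX + \<mu>Y\<^sup>2 / vY"
  define P where "P = 1 / (2 * pi * sqrt (vX * vY))"
  define h where "h j = exp (- (\<kappa> / (2 * n)) * (real j - n)\<^sup>2)" for j
  have fin: "finite J" by (simp add: J_def)
  have J: "n / 8 \<le> real j" "real j \<le> 8 * n" "j \<ge> 1" if "j \<in> J" for j
  proof -
    show "n / 8 \<le> real j" using that n by (auto simp: J_def nat_le_iff ceiling_le_iff)
    then show "j \<ge> 1" using n by (cases j) auto
    show "real j \<le> 8 * n" using that n by (auto simp: J_def le_nat_iff le_floor_iff)
  qed
  have cardJ: "real (card J) \<le> 8 * n"
  proof -
    have "nat \<lceil>n / 8\<rceil> \<ge> 1" using n by linarith
    then have "card J \<le> nat \<lfloor>8 * n\<rfloor>" by (simp add: J_def)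
    then show ?thesis using n by linarith
  qed
  have v0: "vX > 0" "vY > 0" using vX vY by linarith+
  have gA_le: "gA j \<le> 8 / sqrt n * e j" and gB_le: "gB j \<le> 8 / sqrt n * e j" if "j \<in> J" for j
    unfolding gA_def gB_def e_def using J[OF that] n \<mu>X \<mu>Y vX vY by (intro gdens_le; simp)+
  have gA0: "gA j \<ge> 0" and gB0: "gB j \<ge> 0" for j
    using v0 by (auto simp: gA_def gB_def gdens_nonneg)
  have sum_e: "(\<Sum>j\<in>J. e j) \<le> gauss_sum_const (1 / 32) * sqrt n"
    unfolding e_def using n by (intro gauss_sum_scaled_le fin) auto
  have \<kappa>1: "\<kappa> \<ge> 1"
  proof -
    have "1\<^sup>2 / 2 \<le> \<mu>X\<^sup>2 / vX" "1\<^sup>2 / 2 \<le> \<mu>Y\<^sup>2 / vY"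
      using \<mu>X \<mu>Y vX vY v0 by (intro frac_le power_mono; simp)+
    then show ?thesis unfolding \<kappa>_def power_one by linarith
  qed
  have \<kappa>2: "\<kappa> \<le> 360"
  proof -
    have "\<mu>X\<^sup>2 / vX \<le> 2\<^sup>2 / (1 / 45)" "\<mu>Y\<^sup>2 / vY \<le> 2\<^sup>2 / (1 / 45)"
      using \<mu>X \<mu>Y vX vY v0 by (intro frac_le power_mono; simp)+
    moreover have "2\<^sup>2 / (1 / 45) = (180 :: real)" by simp
    ultimately show ?thesis unfolding \<kappa>_def by linarith
  qed
  have P: "0 \<le> P" "P \<le> 8"
  proof -
    show "0 \<le> P" using v0 by (simp add: P_def)
    have "(1 / 45) * (1 / 45) \<le> vX * vY" using vX vY by (intro mult_mono) auto
    then have "1 / 45 \<le> sqrt (vX * vY)" by (intro real_le_rsqrt) (simp add: power2_eq_square)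
    then have "2 * 3 * (1 / 45) \<le> 2 * pi * sqrt (vX * vY)" using pi_gt3 by (intro mult_mono) auto
    then have "P \<le> 1 / (2 * 3 * (1 / 45))" unfolding P_def by (intro frac_le) auto
    then show "P \<le> 8" by simp
  qed
  have gAB: "gA j * gB j = P * (exp (- (\<kappa> * (real j - n)\<^sup>2) / (2 * real j)) / real j)" if "j \<in> J" for j
  proof -
    have j: "real j > 0" using J[OF that] by simp
    have "sqrt (2 * pi * (real j * vX)) * sqrt (2 * pi * (real j * vY)) = sqrt ((2 * pi * real j)\<^sup>2 * (vX * vY))"
      by (simp add: power2_eq_square mult_ac flip: real_sqrt_mult)
    also have "\<dots> = 2 * pi * real j * sqrt (vX * vY)"
      using j by (simp only: real_sqrt_mult real_sqrt_abs) simp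
    finally have s: "sqrt (2 * pi * (real j * vX)) * sqrt (2 * pi * (real j * vY)) = 2 * pi * real j * sqrt (vX * vY)" .
    have "- (n * \<mu>X - real j * \<mu>X)\<^sup>2 / (2 * (real j * vX)) + - (n * \<mu>Y - real j * \<mu>Y)\<^sup>2 / (2 * (real j * vY))
        = - (\<kappa> * (real j - n)\<^sup>2) / (2 * real j)"
      using j v0 unfolding \<kappa>_def by (simp add: divide_simps) (simp add: power2_eq_square algebra_simps)
    then have ex: "exp (- (n * \<mu>X - real j * \<mu>X)\<^sup>2 / (2 * (real j * vX))) * exp (- (n * \<mu>Y - real j * \<mu>Y)\<^sup>2 / (2 * (real j * vY)))
        = exp (- (\<kappa> * (real j - n)\<^sup>2) / (2 * real j))"
      by (simp only: exp_add[symmetric])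
    show ?thesis
      unfolding gA_def gB_def gdens_def times_divide_times_eq ex s P_def by simp
  qed
  have "cmod (A j * B j - of_real (gA j * gB j)) \<le> 64 * C\<^sup>2 / n\<^sup>2 + 8 * C / n * (16 / sqrt n * e j)" if j: "j \<in> J" for j
  proof -
    note Jj = J[OF j]
    have "C / real j \<le> C / (n / 8)" using Jj C n by (intro divide_left_mono) auto
    then have Cj: "C / real j \<le> 8 * C / n" by (simp add: mult.commute)
    have a: "cmod (A j - of_real (gA j)) \<le> 8 * C / n" using A[OF Jj(3)] Cj unfolding gA_def by linarith
    have b: "cmod (B j - of_real (gB j)) \<le> 8 * C / n" using B[OF Jj(3)] Cj unfolding gB_def by linarith
    have "A j * B j - of_real (gA j * gB j) = (A j - of_real (gA j)) * (B j - of_real (gB j))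
        + ((A j - of_real (gA j)) * of_real (gB j) + of_real (gA j) * (B j - of_real (gB j)))"
      by (simp add: algebra_simps)
    also have "cmod \<dots> \<le> (8 * C / n) * (8 * C / n) + ((8 * C / n) * (8 / sqrt n * e j) + (8 / sqrt n * e j) * (8 * C / n))"
      by (intro norm_triangle_mono; unfold norm_mult; intro mult_mono a b)
         (use gA_le[OF j] gB_le[OF j] gA0[of j] gB0[of j] C n in \<open>auto simp: e_def\<close>)
    also have "\<dots> = 64 * C\<^sup>2 / n\<^sup>2 + 8 * C / n * (16 / sqrt n * e j)"
      by (simp add: power2_eq_square)
    finally show ?thesis .
  qed
  then have "cmod (\<Sum>j\<in>J. A j * B j - of_real (gA j * gB j)) \<le> (\<Sum>j\<in>J. 64 * C\<^sup>2 / n\<^sup>2 + 8 * C / n * (16 / sqrt n * e j))"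
    by (rule sum_norm_le)
  also have "\<dots> = real (card J) * (64 * C\<^sup>2 / n\<^sup>2) + 8 * C / n * (16 / sqrt n * (\<Sum>j\<in>J. e j))"
    by (simp add: sum.distrib sum_distrib_left)
  also have "\<dots> \<le> 8 * n * (64 * C\<^sup>2 / n\<^sup>2) + 8 * C / n * (16 / sqrt n * (gauss_sum_const (1 / 32) * sqrt n))"
    using cardJ sum_e C n by (intro add_mono mult_mono mult_left_mono) auto
  also have "\<dots> = (512 * C\<^sup>2 + 128 * C * gauss_sum_const (1 / 32)) / n"
    using n by (simp add: power2_eq_square add_divide_distrib)
  finally have E1: "cmod (\<Sum>j\<in>J. A j * B j - of_real (gA j * gB j)) \<le> (512 * C\<^sup>2 + 128 * C * gauss_sum_const (1 / 32)) / n" .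
  have "\<bar>gA j * gB j - P / n * h j\<bar> \<le> 8 * (128 * sqrt 32 / n powr (3 / 2) * exp (- ((1 / 64) / n) * (real j - n)\<^sup>2))" if j: "j \<in> J" for j
  proof -
    have "gA j * gB j - P / n * h j =
      P * (exp (- (\<kappa> * (real j - n)\<^sup>2) / (2 * real j)) / real j - exp (- (\<kappa> * (real j - n)\<^sup>2) / (2 * n)) / n)"
      unfolding gAB[OF j] by (simp add: h_def algebra_simps)
    also have "\<bar>\<dots>\<bar> \<le> 8 * (128 * sqrt 32 / n powr (3 / 2) * exp (- ((1 / 64) / n) * (real j - n)\<^sup>2))"
      unfolding abs_mult using P J[OF j] n \<kappa>1 by (intro mult_mono exp_neg_inverse_divide_diff_le) auto
    finally show ?thesis .
  qed
  then have "\<bar>\<Sum>j\<in>J. gA j * gB j - P / n * h j\<bar> \<le> (\<Sum>j\<in>J. 8 * (128 * sqrt 32 / n powr (3 / 2) * exp (- ((1 / 64) / n) * (real j - n)\<^sup>2)))"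
    by (intro order_trans[OF sum_abs] sum_mono)
  also have "\<dots> = 1024 * sqrt 32 / n powr (3 / 2) * (\<Sum>j\<in>J. exp (- ((1 / 64) / n) * (real j - n)\<^sup>2))"
    by (simp add: sum_distrib_left mult.assoc)
  also have "\<dots> \<le> 1024 * sqrt 32 / n powr (3 / 2) * (gauss_sum_const (1 / 64) * sqrt n)"
    using n by (intro mult_left_mono gauss_sum_scaled_le fin) auto
  also have "\<dots> = 1024 * sqrt 32 * gauss_sum_const (1 / 64) / n"
  proof -
    have "n powr (3 / 2) = n * sqrt n"
      using n powr_add[of n 1 "1 / 2"] by (simp add: powr_half_sqrt)
    then show ?thesis using n by simp
  qed
  finally have E2: "\<bar>\<Sum>j\<in>J. gA j * gB j - P / n * h j\<bar> \<le> 1024 * sqrt 32 * gauss_sum_const (1 / 64) / n" .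
  \<comment> \<open>The choice R = n/4 works at both ends of the window: n \<ge> 4 gives n/8 + 1
    \<le> 3 n / 4, and the upper end lies beyond 2 n.\<close>
  have "\<bar>(\<Sum>j\<in>J. h j) - sqrt (pi / (\<kappa> / (2 * n)))\<bar> \<le> 4 * sqrt pi * exp (\<kappa> / (2 * n) / 2) + sqrt (2 * pi) / (n / 4 * (\<kappa> / (2 * n)))"
    unfolding J_def h_def
  proof (rule gauss_sum_approx)
    fix t :: real
    assume "t < real (nat \<lceil>n / 8\<rceil>)"
    then have "t < n / 8 + 1" using n by linarith
    then show "n / 4 \<le> \<bar>t - n\<bar>" using n by linarith
  next
    fix t :: real
    assume "real (nat \<lfloor>8 * n\<rfloor>) + 1 \<le> t"
    then have "8 * n \<le> t" using n by linarith
    then show "n / 4 \<le> \<bar>t - n\<bar>" using n by linarith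
  qed (use n \<kappa>1 in auto)
  also have "sqrt (2 * pi) / (n / 4 * (\<kappa> / (2 * n))) = sqrt (2 * pi) * 8 / \<kappa>" using n by simp
  also have "\<dots> \<le> sqrt (2 * pi) * 8 / 1" using \<kappa>1 by (intro divide_left_mono) auto
  also have "4 * sqrt pi * exp (\<kappa> / (2 * n) / 2) \<le> 4 * sqrt pi * exp 90"
  proof -
    have "\<kappa> / (2 * n) / 2 \<le> 360 / 4" using n \<kappa>1 \<kappa>2 by (simp add: field_simps)
    then show ?thesis by (intro mult_left_mono) auto
  qed
  finally have h: "\<bar>(\<Sum>j\<in>J. h j) - sqrt (pi / (\<kappa> / (2 * n)))\<bar> \<le> 4 * sqrt pi * exp 90 + 8 * sqrt (2 * pi)"
    by simp
  have "\<bar>P / n * (\<Sum>j\<in>J. h j) - P / n * sqrt (pi / (\<kappa> / (2 * n)))\<bar> = P / n * \<bar>(\<Sum>j\<in>J. h j) - sqrt (pi / (\<kappa> / (2 * n)))\<bar>"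
    unfolding right_diff_distrib[symmetric] abs_mult using P n by simp
  also have "\<dots> \<le> 8 / n * (4 * sqrt pi * exp 90 + 8 * sqrt (2 * pi))"
    using h P n by (intro mult_mono divide_right_mono) auto
  finally have E3: "\<bar>P / n * (\<Sum>j\<in>J. h j) - P / n * sqrt (pi / (\<kappa> / (2 * n)))\<bar> \<le> 8 * (4 * sqrt pi * exp 90 + 8 * sqrt (2 * pi)) / n"
    by simp
  have T: "P / n * sqrt (pi / (\<kappa> / (2 * n))) = 1 / sqrt (2 * pi * n * (\<mu>X\<^sup>2 * vY + \<mu>Y\<^sup>2 * vX))"
  proof -
    have "2 * pi * n * (\<mu>X\<^sup>2 * vY + \<mu>Y\<^sup>2 * vX) = (2 * pi * n)\<^sup>2 * (vX * vY) / (pi / (\<kappa> / (2 * n)))"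
      using n v0 \<kappa>1 unfolding \<kappa>_def by (simp add: field_simps power2_eq_square)
    then have "sqrt (2 * pi * n * (\<mu>X\<^sup>2 * vY + \<mu>Y\<^sup>2 * vX)) = 2 * pi * n * sqrt (vX * vY) / sqrt (pi / (\<kappa> / (2 * n)))"
      using n by (simp only: real_sqrt_divide real_sqrt_mult real_sqrt_abs) simp
    then show ?thesis by (simp add: P_def)
  qed
  have "(\<Sum>j\<in>J. A j * B j) - of_real (1 / sqrt (2 * pi * n * (\<mu>X\<^sup>2 * vY + \<mu>Y\<^sup>2 * vX))) =
      (\<Sum>j\<in>J. A j * B j - of_real (gA j * gB j)) + (of_real (\<Sum>j\<in>J. gA j * gB j - P / n * h j)
      + of_real (P / n * (\<Sum>j\<in>J. h j) - P / n * sqrt (pi / (\<kappa> / (2 * n)))))"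
    unfolding T[symmetric] by (simp add: sum_subtractf sum_distrib_left)
  also have "cmod \<dots> \<le> (512 * C\<^sup>2 + 128 * C * gauss_sum_const (1 / 32)) / n
      + (1024 * sqrt 32 * gauss_sum_const (1 / 64) / n + 8 * (4 * sqrt pi * exp 90 + 8 * sqrt (2 * pi)) / n)"
    by (intro norm_triangle_mono E1; unfold norm_of_real; intro E2 E3)
  also have "\<dots> = renewal_const C / n" by (simp add: renewal_const_def add_divide_distrib)
  finally show ?thesis by (simp add: J_def)
qed

section \<open>The saddle point\<close>

text \<open>The involution x -> y given by e^(-x) + e^(-y) = 1, which parametrises the positive
  branch of the singular curve (e^x - 1)(e^y - 1) = 1 of the generating function.\<close>

definition dual :: "real \<Rightarrow> real" where "dual x = - ln (1 - exp (- x))"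

lemma exp_minus_dual: "x > 0 \<Longrightarrow> exp (- dual x) = 1 - exp (- x)"
  by (simp add: dual_def)

lemma dual_pos: "x > 0 \<Longrightarrow> dual x > 0"
  by (simp add: dual_def ln_less_zero)

lemma dual_dual: "x > 0 \<Longrightarrow> dual (dual x) = x"
  using exp_minus_dual[of x] by (simp add: dual_def[of "dual x"])

lemma dual_antimono: "0 < x \<Longrightarrow> x \<le> y \<Longrightarrow> dual y \<le> dual x"
  by (simp add: dual_def)

text \<open>With y = \<open>dual x\<close> this is y e^(-y) / (x e^(-x)), the ratio of the truncated
  Poisson means at y and x. Exchanging x and y inverts it.\<close>

lemma fpm_eq: "x > 0 \<Longrightarrow> fpm x = exp (- dual x) / exp (- x) * (dual x / x)"
proof -
  assume x: "x > 0"
  have "1 - exp x = - ((1 - exp (- x)) / exp (- x))" by (simp add: exp_minus field_simps)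
  then show ?thesis unfolding fpm_def exp_minus_dual[OF x] by (simp add: dual_def)
qed

lemma fpm_dual: "x > 0 \<Longrightarrow> fpm x * fpm (dual x) = 1"
  using dual_pos[of x] by (simp add: fpm_eq dual_dual)

lemma fpm_pos: "x > 0 \<Longrightarrow> fpm x > 0"
  using dual_pos[of x] by (simp add: fpm_eq)

lemma mult_exp_minus_less: "x > 0 \<Longrightarrow> x * exp (- x) < 1 - exp (- x)" for x :: real
proof -
  assume x: "x > 0"
  then have "x < exp x - 1" using ln_add_one_self_less_self[of "exp x - 1"] by simp
  then have "x * exp (- x) < (exp x - 1) * exp (- x)" by (rule mult_strict_right_mono) simp
  then show ?thesis by (simp add: algebra_simps flip: exp_add)
qed

text \<open>Write xy = xy (e^(-x) + e^(-y)) and apply t e^(-t) < 1 - e^(-t) to each part. The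
  difference of the two sides is the bracket in \<open>Qxy\<close>.\<close>

lemma dual_mult_less:
  assumes x: "x > 0"
  shows "x * dual x < x * exp (- x) + dual x * exp (- dual x)"
proof -
  define y where "y = dual x"
  have y: "y > 0" "exp (- y) = 1 - exp (- x)" using x by (simp_all add: y_def dual_pos exp_minus_dual)
  have "y * (x * exp (- x)) < y * exp (- y)"
    using mult_exp_minus_less[OF x] y by (intro mult_strict_left_mono) auto
  moreover have "x * (y * exp (- y)) < x * exp (- x)"
    using mult_exp_minus_less[OF y(1)] y x by (intro mult_strict_left_mono) auto
  moreover have "y * (x * exp (- x)) + x * (y * exp (- y)) = x * y" by (simp add: y algebra_simps)
  ultimately show ?thesis unfolding y_def[symmetric] by linarith
qed

lemma fpm_has_real_derivative:
  assumes t: "t > 0"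
  shows "(fpm has_real_derivative ((t * exp t * dual t - t - (exp t - 1) * dual t) / t\<^sup>2)) (at t)"
proof -
  have p: "1 - exp (- t) > 0" using t by simp
  have "exp (- t) * (1 - exp t) / (1 - exp (- t)) = - 1"
  proof -
    have "exp (- t) * (1 - exp t) = - (1 - exp (- t))" by (simp add: algebra_simps flip: exp_add)
    moreover have "- d / d = - 1" if "d > 0" for d :: real using that by simp
    note this[OF p]
    ultimately show ?thesis by (simp only:)
  qed
  then have D: "((\<lambda>t. (1 - exp t) * ln (1 - exp (- t))) has_real_derivative (exp t * dual t - 1)) (at t)"
    using p by (auto intro!: derivative_eq_intros simp: dual_def)
  have "((\<lambda>t. (1 - exp t) * ln (1 - exp (- t)) / t) has_real_derivative
      ((exp t * dual t - 1) * t - (1 - exp t) * ln (1 - exp (- t)) * 1) / (t * t)) (at t)"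
    using t by (intro DERIV_divide D DERIV_ident) auto
  then show ?thesis
    by (simp add: fpm_def [abs_def] dual_def power2_eq_square algebra_simps)
qed

lemma fpm_strict_antimono:
  assumes "0 < a" "a < b"
  shows "fpm b < fpm a"
proof (rule DERIV_neg_imp_decreasing[OF assms(2)])
  fix t assume "a \<le> t" "t \<le> b"
  then have t: "t > 0" using assms by simp
  \<comment> \<open>Multiplied by e^t, \<open>dual_mult_less\<close> says exactly that the numerator
    of the derivative is negative.\<close>
  have "exp t * (t * dual t) < exp t * (t * exp (- t) + dual t * exp (- dual t))"
    using dual_mult_less[OF t] by simp
  also have "\<dots> = t + (exp t - 1) * dual t"
    unfolding exp_minus_dual[OF t] by (simp add: algebra_simps exp_minus)
  finally have "(t * exp t * dual t - t - (exp t - 1) * dual t) / t\<^sup>2 < 0"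
    using t by (intro divide_neg_pos) (auto simp: mult_ac)
  then show "\<exists>y. DERIV fpm t :> y \<and> y < 0" using fpm_has_real_derivative[OF t] by blast
qed

lemma fpm_inv_fpm: "x > 0 \<Longrightarrow> fpm_inv (fpm x) = x"
  unfolding fpm_inv_def
proof (rule the_equality)
  fix t assume x: "x > 0" and t: "t > 0 \<and> fpm t = fpm x"
  show "t = x"
  proof (rule linorder_cases[of t x])
    assume "t < x" then show ?thesis using fpm_strict_antimono[of t x] t by simp
  next
    assume "x < t" then show ?thesis using fpm_strict_antimono[of x t] x t by simp
  qed
qed auto

text \<open>The origin of the constant: as f decreases, s/r \<ge> \<open>eps0\<close> means x \<le>
  1, and symmetrically s/r \<le> 1/\<open>eps0\<close> means y \<le> 1.\<close>

lemma fpm_1: "fpm 1 = eps0"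
proof -
  have "1 - exp (- 1 :: real) = (exp 1 - 1) / exp 1" by (simp add: exp_minus field_simps)
  then have "ln (1 - exp (- 1 :: real)) = ln (exp 1 - 1) - 1"
    using exp_gt_one[of "1::real"] by (simp add: ln_div)
  then show ?thesis unfolding fpm_def eps0_def by (simp only: div_by_1) (simp add: algebra_simps)
qed

text \<open>Source of the lower end 1/3: -ln (1 - u) \<ge> u at u = 1/e, with e \<le> 3.\<close>

lemma dual_1_bounds: "1 / 3 \<le> dual 1" "dual 1 \<le> 1"
proof -
  have "exp (- 1 :: real) \<ge> 1 / 3" using exp_le by (simp add: exp_minus field_simps)
  moreover have "exp (- 1) \<le> dual 1"
    using ln_le_minus_one[of "1 - exp (- 1 :: real)"] by (simp add: dual_def)
  ultimately show "1 / 3 \<le> dual 1" by linarith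
  have "2 \<le> exp (1 :: real)" using exp_ge_add_one_self[of "1 :: real"] by simp
  then have "exp (- 1 :: real) \<le> 1 / 2" by (simp add: exp_minus field_simps)
  then have "exp (- 1 :: real) \<le> exp (- dual 1)" by (simp add: exp_minus_dual)
  then show "dual 1 \<le> 1" by simp
qed

text \<open>Between \<open>dual 1\<close> and 1 the function f falls from 1/\<open>eps0\<close> to
  \<open>eps0\<close>, so the intermediate value theorem finds x there; the involution maps this
  interval to itself, which bounds y as well.\<close>

lemma fpm_inv_range:
  assumes "eps0 \<le> v" "v \<le> 1 / eps0"
  obtains x where "fpm x = v" "1 / 3 \<le> x" "x \<le> 1" "1 / 3 \<le> dual x" "dual x \<le> 1"
    "fpm_inv v = x" "fpm_inv (1 / v) = dual x"
proof -
  have d0: "dual 1 > 0" using dual_1_bounds by linarith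
  have e0: "eps0 > 0" using fpm_pos[of 1] by (simp add: fpm_1)
  have "fpm (dual 1) = 1 / eps0" using fpm_dual[of 1] e0 by (simp add: fpm_1 field_simps)
  then have "\<exists>x. dual 1 \<le> x \<and> x \<le> 1 \<and> fpm x = v"
    using assms dual_1_bounds d0
    by (intro IVT2' continuous_at_imp_continuous_on ballI DERIV_isCont[OF fpm_has_real_derivative]) (auto simp: fpm_1)
  then obtain x where x: "dual 1 \<le> x" "x \<le> 1" "fpm x = v" by blast
  have x0: "x > 0" using x d0 by linarith
  have "dual x \<le> dual (dual 1)" using x d0 by (intro dual_antimono)
  moreover have "dual 1 \<le> dual x" using x x0 by (intro dual_antimono)
  moreover have "fpm (dual x) = 1 / v"
    using fpm_dual[OF x0] fpm_pos[OF x0] by (simp add: x(3) field_simps)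
  ultimately show thesis
    using that[of x] x dual_1_bounds fpm_inv_fpm[OF x0] fpm_inv_fpm[OF dual_pos[OF x0]] by (simp add: dual_dual)
qed

section \<open>From the probabilities to the asymptotic formula\<close>

text \<open>On the curve (e^x - 1)(e^y - 1) = 1 the normalisations of the two probabilities cancel
  for every j, leaving only e^x from the Poisson factor.\<close>

lemma ba_count_Acoef_Bcoef:
  assumes r: "r \<ge> 1" and x: "1 / 3 \<le> x" "x \<le> 1" and y: "1 / 3 \<le> y" "y \<le> 1"
    and xy: "exp (- x) + exp (- y) = 1"
  shows "of_nat (ba_count (r - 1) s) * of_real x ^ r * of_real y ^ s =
    fact r * fact s * of_real (exp x) * (\<Sum>j\<le>r. Acoef x r j * Bcoef y s j)"
proof -
  have "(exp x - 1) * (exp y - 1) = 1"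
  proof -
    have "(exp x - 1) * (exp y - 1) = exp x * exp y * (1 - (exp (- x) + exp (- y))) + 1"
      by (simp add: algebra_simps exp_minus)
    then show ?thesis by (simp add: xy)
  qed
  then have 1: "complex_of_real (exp x - 1) * of_real (exp y - 1) = 1"
    by (metis of_real_1 of_real_mult)
  define D where "D = complex_of_real (exp x - 1)"
  define D' where "D' = complex_of_real (exp y - 1)"
  define W where "W = complex_of_real (exp x)"
  have DD: "D * D' = 1" using 1 by (simp only: D_def D'_def)
  then have nz: "D ^ j * D' ^ j = 1" "D \<noteq> 0" "D' \<noteq> 0" "W \<noteq> 0" for j
    by (auto simp: W_def simp flip: power_mult_distrib)
  have "W * (Acoef x r j * Bcoef y s j) = fps_nth (fps_exp 1 * (fps_exp 1 - 1) ^ j) r * fps_nth ((fps_exp 1 - 1) ^ j) s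
     * of_real x ^ r * of_real y ^ s" if "j \<le> r" for j
  proof -
    have "W * (Acoef x r j * Bcoef y s j) = fps_nth (fps_exp 1 * (fps_exp 1 - 1) ^ j) r * fps_nth ((fps_exp 1 - 1) ^ j) s
     * of_real x ^ r * of_real y ^ s / (D ^ j * D' ^ j)"
      unfolding Acoef_def Bcoef_def D_def[symmetric] D'_def[symmetric] W_def[symmetric]
      using nz by simp
    then show ?thesis by (simp add: nz)
  qed
  then have "W * (\<Sum>j\<le>r. Acoef x r j * Bcoef y s j) =
      (\<Sum>j\<le>r. fps_nth (fps_exp 1 * (fps_exp 1 - 1) ^ j) r * fps_nth ((fps_exp 1 - 1) ^ j) s) * of_real x ^ r * of_real y ^ s"
    by (simp add: sum_distrib_left sum_distrib_right)
  then show ?thesis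
    unfolding ba_count_eq_sum[OF r] W_def[symmetric] by (simp add: mult_ac)
qed

text \<open>For j < n/8 \<le> s/8 the exponent 4 j - s is below -s/2, so
  \<open>norm_Bcoef_le\<close> beats the number of terms, while the other probability is at most
  1.\<close>

lemma small_index_sum_le:
  assumes x: "1 / 3 \<le> x" "x \<le> 1" and y: "1 / 3 \<le> y" "y \<le> 1"
    and n: "4 \<le> n" "n \<le> real s"
  shows "cmod (\<Sum>j<nat \<lceil>n / 8\<rceil>. Acoef x r j * Bcoef y s j) \<le> 8 / n"
proof -
  have "cmod (\<Sum>j<nat \<lceil>n / 8\<rceil>. Acoef x r j * Bcoef y s j) \<le> (\<Sum>j<nat \<lceil>n / 8\<rceil>. exp (- (real s / 2)))"
  proof (rule sum_norm_le)
    fix j assume "j \<in> {..<nat \<lceil>n / 8\<rceil>}"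
    then have "real j < n / 8" by (simp add: zless_nat_eq_int_zless less_ceiling_iff)
    then have "4 * real j - real s \<le> - (real s / 2)" using n by linarith
    then have "exp (4 * real j - real s) \<le> exp (- (real s / 2))" by simp
    then have "cmod (Bcoef y s j) \<le> exp (- (real s / 2))" using norm_Bcoef_le[OF y, of s j] by linarith
    then have "cmod (Acoef x r j) * cmod (Bcoef y s j) \<le> 1 * exp (- (real s / 2))"
      using norm_Acoef_le[OF x, of r j] by (intro mult_mono) auto
    then show "cmod (Acoef x r j * Bcoef y s j) \<le> exp (- (real s / 2))" by (simp add: norm_mult)
  qed
  also have "\<dots> = real (nat \<lceil>n / 8\<rceil>) * exp (- (real s / 2))" by simp
  also have "\<dots> \<le> real s * (8 / real s ^ 2)"
  proof (rule mult_mono)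
    show "real (nat \<lceil>n / 8\<rceil>) \<le> real s" using n by linarith
    have "(real s / 2)\<^sup>2 / 2 \<le> exp (real s / 2)"
      using exp_lower_Taylor_quadratic[of "real s / 2"] by simp
    then show "exp (- (real s / 2)) \<le> 8 / real s ^ 2"
      using n by (simp add: exp_minus field_simps)
  qed auto
  also have "\<dots> = 8 / real s" using n by (simp add: power2_eq_square)
  also have "\<dots> \<le> 8 / n" using n by (intro divide_left_mono) auto
  finally show ?thesis .
qed

text \<open>The left side is the combination produced by \<open>renewal_sum_bound\<close>. With p =
  e^(-x), q = e^(-y) and p + q = 1 all means and variances are rational in x, y, p, q.\<close>

lemma Qxy_eq:
  assumes "0 < x" "0 < y" and xy: "exp (- x) + exp (- y) = 1"
  shows "(tpois_mean x)\<^sup>2 * tpois_var y + (tpois_mean y)\<^sup>2 * tpois_var x = Qxy x y / (exp (- x) * exp (- y)) ^ 3"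
proof -
  define p where "p = exp (- x)"
  define q where "q = exp (- y)"
  have pq: "p > 0" "q > 0" "1 - p = q" "1 - q = p" "p + q = 1" using xy by (auto simp: p_def q_def)
  have mx: "tpois_mean x = x / q" and my: "tpois_mean y = y / p" by (simp_all add: tpois_mean_def pq flip: p_def q_def)
  have vx: "tpois_var x = x / q\<^sup>2 * (q - x * p)"
  proof -
    have "1 + x - x / q = (q + x * (q - 1)) / q" using pq by (simp add: field_simps)
    also have "q - 1 = - p" using pq by simp
    finally show ?thesis by (simp add: tpois_var_def mx power2_eq_square)
  qed
  have vy: "tpois_var y = y / p\<^sup>2 * (p - y * q)"
  proof -
    have "1 + y - y / p = (p + y * (p - 1)) / p" using pq by (simp add: field_simps)
    also have "p - 1 = - q" using pq by simp
    finally show ?thesis by (simp add: tpois_var_def my power2_eq_square)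
  qed
  have "exp (- x - y) = p * q" by (simp add: p_def q_def flip: exp_add)
  then have Q: "Qxy x y = x * y * (p * q) * (y * q + x * p - x * y * (q + p))"
    by (simp add: Qxy_def p_def q_def)
  have "(tpois_mean x)\<^sup>2 * tpois_var y + (tpois_mean y)\<^sup>2 * tpois_var x
      = x * y / (p\<^sup>2 * q\<^sup>2) * (x * (p - y * q) + y * (q - x * p))"
    unfolding mx my vx vy using pq by (simp add: field_simps power2_eq_square)
  also have "\<dots> = Qxy x y / (p * q) ^ 3"
    unfolding Q using pq(1,2) by (simp add: divide_simps power2_eq_square power3_eq_cube) (simp add: algebra_simps)
  finally show ?thesis by (simp add: p_def q_def)
qed

theorem theorem1p3:
  "\<exists>C N. \<forall>r s. (r, s) \<in> S_eps0 \<and> r \<ge> N \<and> s \<ge> N \<longrightarrow>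
     (let x = fpm_inv (real s / real r); y = fpm_inv (real r / real s) in
      \<exists>E. \<bar>E\<bar> \<le> C / sqrt (real s) \<and>
        real (ba_count (r - 1) s) =
          fact s * fact r * (exp (- y) + E) * (1 / sqrt (2 * pi)) *
          x powi (- int r) * y powi (- int s) *
          sqrt (y * exp (- y) / (real s * Qxy x y)))"
proof -
  define K where "K = renewal_const llt_C + 8"
  have llt_C: "llt_C \<ge> 0"
    by (simp add: llt_C_def llt_const_def add_nonneg_nonneg)
  have K: "K \<ge> 0"
    using llt_C by (simp add: K_def renewal_const_def gauss_sum_const_nonneg add_nonneg_nonneg)
  have main: "\<exists>E. \<bar>E\<bar> \<le> 8 * sqrt pi * K / sqrt (real s) \<and>
        real (ba_count (r - 1) s) =
          fact s * fact r * (exp (- y) + E) * (1 / sqrt (2 * pi)) *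
          x powi (- int r) * y powi (- int s) *
          sqrt (y * exp (- y) / (real s * Qxy x y))"
    if rs: "(r, s) \<in> S_eps0" "r \<ge> 16" "s \<ge> 16"
      and x_def: "x = fpm_inv (real s / real r)" and y_def: "y = fpm_inv (real r / real s)" for r s x y
  proof -
    have range: "eps0 \<le> real s / real r" "real s / real r \<le> 1 / eps0" using rs(1) by (auto simp: S_eps0_def)
    have xy: "fpm x = real s / real r" "1 / 3 \<le> x" "x \<le> 1" "1 / 3 \<le> y" "y \<le> 1" "y = dual x"
      by (rule fpm_inv_range[OF range]; simp add: x_def y_def)+
    have pos: "x > 0" "y > 0" using xy by linarith+
    have eq1: "exp (- x) + exp (- y) = 1" using exp_minus_dual[OF pos(1)] xy(6) by simp
    note mx = tpois_mean_bounds[OF xy(2,3)] and my = tpois_mean_bounds[OF xy(4,5)]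
    note vx = tpois_var_bounds[OF xy(2,3)] and vy = tpois_var_bounds[OF xy(4,5)]
    have mx_eq: "tpois_mean x = x / exp (- y)" and my_eq: "tpois_mean y = y / exp (- x)"
      using eq1 by (simp_all add: tpois_mean_def flip: eq1)
    \<comment> \<open>The real number of summands whose expected totals are (r, s): the second
      coordinate fits by definition, the first because f(x) = s/r is the ratio of the means.\<close>
    define n where "n = real s / tpois_mean y"
    have ns: "n * tpois_mean y = real s" using my by (simp add: n_def)
    have "real s = real r * fpm x" using rs xy by simp
    also have "fpm x = tpois_mean y / tpois_mean x"
      unfolding fpm_eq[OF pos(1)] mx_eq my_eq xy(6)[symmetric] by simp
    finally have nr: "n * tpois_mean x = real r" using mx my by (simp add: n_def field_simps)
    have n_le: "n \<le> real s" "real s \<le> 2 * n"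
    proof -
      have "n > 0" using my rs by (simp add: n_def)
      then have "n * 1 \<le> n * tpois_mean y" "n * tpois_mean y \<le> n * 2" using my by (auto intro!: mult_left_mono)
      then show "n \<le> real s" "real s \<le> 2 * n" by (simp_all add: ns)
    qed
    have n4: "n \<ge> 4" using n_le rs by simp
    define S where "S = (\<Sum>j\<le>r. Acoef x r j * Bcoef y s j)"
    define M where "M = (tpois_mean x)\<^sup>2 * tpois_var y + (tpois_mean y)\<^sup>2 * tpois_var x"
    define T where "T = 1 / sqrt (2 * pi * n * M)"
    let ?a = "nat \<lceil>n / 8\<rceil>" and ?b = "nat \<lfloor>8 * n\<rfloor>"
    have b: "cmod ((\<Sum>j=?a..?b. Acoef x r j * Bcoef y s j) - of_real T) \<le> renewal_const llt_C / n"
      unfolding T_def M_def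
      using Acoef_local_limit[OF xy(2,3)] Bcoef_local_limit[OF xy(4,5)]
      by (intro renewal_sum_bound n4 mx my vx vy llt_C) (simp_all add: nr ns)
    have S_eq: "S = (\<Sum>j<?a. Acoef x r j * Bcoef y s j) + (\<Sum>j=?a..?b. Acoef x r j * Bcoef y s j)"
    proof -
      \<comment> \<open>Since r \<le> 2 n, the window reaches past r; extending the sum there only
        adds zeros.\<close>
      have "n * tpois_mean x \<le> n * 2" using mx n4 by (intro mult_left_mono) auto
      then have "real r \<le> 2 * n" using nr by simp
      then have rb: "r \<le> ?b" using n4 by (simp add: le_nat_iff le_floor_iff)
      have ab: "?a \<le> ?b + 1" using n4 by linarith
      have "S = (\<Sum>j\<le>?b. Acoef x r j * Bcoef y s j)"
        unfolding S_def using rb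
        by (intro sum.mono_neutral_left)
           (auto simp: Acoef_def fps_exp_minus_one_power_nth_eq_0)
      also have "{..?b} = {..<?a} \<union> {?a..?b}"
      proof -
        have "{..b} = {..<a} \<union> {a..b}" if "a \<le> b + 1" for a b :: nat using that by auto
        from this[OF ab] show ?thesis .
      qed
      also have "(\<Sum>j\<in>{..<?a} \<union> {?a..?b}. Acoef x r j * Bcoef y s j) =
          (\<Sum>j<?a. Acoef x r j * Bcoef y s j) + (\<Sum>j=?a..?b. Acoef x r j * Bcoef y s j)"
      proof (rule sum.union_disjoint)
        have "{..<a} \<inter> {a..b} = {}" for a b :: nat by auto
        then show "{..<?a} \<inter> {?a..?b} = {}" .
      qed simp_all
      finally show ?thesis .
    qed
    have "S - of_real T = (\<Sum>j<?a. Acoef x r j * Bcoef y s j) + ((\<Sum>j=?a..?b. Acoef x r j * Bcoef y s j) - of_real T)"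
      unfolding S_eq by simp
    also have "cmod \<dots> \<le> 8 / n + renewal_const llt_C / n"
      by (intro norm_triangle_mono b small_index_sum_le xy n4 n_le)
    finally have ST: "cmod (S - of_real T) \<le> K / n" by (simp add: K_def add_divide_distrib)
    define X where "X = real (ba_count (r - 1) s) * x ^ r * y ^ s / (fact r * fact s)"
    have "of_nat (ba_count (r - 1) s) * of_real x ^ r * of_real y ^ s = fact r * fact s * of_real (exp x) * S"
      unfolding S_def using rs by (intro ba_count_Acoef_Bcoef xy eq1) auto
    then have XS: "complex_of_real X = of_real (exp x) * S" by (simp add: X_def field_simps)
    have "complex_of_real (X - exp x * T) = of_real (exp x) * (S - of_real T)"
      by (simp add: XS algebra_simps flip: exp_of_real)
    then have "\<bar>X - exp x * T\<bar> = exp x * cmod (S - of_real T)"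
      by (metis norm_of_real norm_mult abs_exp_cancel)
    also have "\<dots> \<le> exp x * (K / n)" using ST by (intro mult_left_mono) auto
    finally have XT: "\<bar>X - exp x * T\<bar> \<le> exp x * (K / n)" .
    have M: "0 < M" "M \<le> 16"
    proof -
      show "0 < M" unfolding M_def using mx my vx vy by (intro add_pos_pos mult_pos_pos) auto
      have "(tpois_mean x)\<^sup>2 * tpois_var y \<le> 2\<^sup>2 * 2" "(tpois_mean y)\<^sup>2 * tpois_var x \<le> 2\<^sup>2 * 2"
        using mx my vx vy by (intro mult_mono power_mono; simp)+
      then show "M \<le> 16" by (simp add: M_def)
    qed
    have Tpos: "T > 0" using M n4 by (simp add: T_def)
    \<comment> \<open>The factor multiplying e^(-y) + E in the claim, apart from factorials and
      powers. It equals e^(x + y) T, so the approximation e^x T of X is e^(-y) G; this produces the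
      leading term e^(-y).\<close>
    define G where "G = 1 / sqrt (2 * pi) * sqrt (y * exp (- y) / (real s * Qxy x y))"
    have G: "G = exp (x + y) * T"
    proof -
      have Q: "Qxy x y = M * (exp (- x) * exp (- y)) ^ 3"
        using Qxy_eq[OF pos eq1] by (simp add: M_def)
      have "y * exp (- y) / (real s * Qxy x y) = (exp (x + y))\<^sup>2 / (n * M)"
        unfolding Q n_def my_eq using pos M rs
        by (simp add: exp_minus exp_add field_simps power2_eq_square power3_eq_cube)
      then have "G = sqrt ((exp (x + y))\<^sup>2 / (2 * pi * n * M))"
        unfolding G_def by (simp add: mult.assoc flip: real_sqrt_divide real_sqrt_mult)
      then show ?thesis by (simp add: T_def real_sqrt_divide)
    qed
    have Gpos: "G > 0" using Tpos by (simp add: G)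
    \<comment> \<open>With this choice the claimed identity holds by construction, and only the size
      of E is at stake.\<close>
    define E where "E = X / G - exp (- y)"
    have EG: "E * G = X - exp x * T"
      using Gpos by (simp add: E_def left_diff_distrib) (simp add: G exp_add exp_minus)
    have "\<bar>E\<bar> * G \<le> exp x * (K / n)" using XT Gpos by (simp add: abs_mult flip: EG)
    then have "\<bar>E\<bar> \<le> exp x * (K / n) / G" by (simp only: pos_le_divide_eq[OF Gpos])
    also have "\<dots> = exp (- y) * (K / (n * T))" by (simp add: G exp_add exp_minus field_simps)
    also have "\<dots> \<le> 1 * (K / (n * T))" using K n4 Tpos pos by (intro mult_right_mono) auto
    \<comment> \<open>T has order n^(-1/2), so an error of order 1/n becomes relative order
      n^(-1/2). The bounds M \<le> 16 and n \<ge> s/2 turn this into 8 sqrt pi / sqrt s.\<close>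
    also have "K / (n * T) = K * (sqrt (2 * pi * M) / sqrt n)"
    proof -
      have "sqrt (2 * pi * n * M) / n = sqrt (2 * pi * M) / sqrt n"
        using n4 by (simp add: real_sqrt_mult field_simps)
      moreover have "K / (n * T) = K * (sqrt (2 * pi * n * M) / n)" by (simp add: T_def)
      ultimately show ?thesis by (simp only:)
    qed
    also have "\<dots> \<le> K * (8 * sqrt pi / sqrt (real s))"
    proof (rule mult_left_mono[OF _ K])
      have "sqrt (2 * pi * M) / sqrt n = sqrt (2 * pi * M / n)" by (simp add: real_sqrt_divide)
      also have "\<dots> \<le> sqrt (2 * pi * 16 / (real s / 2))"
        using M n_le n4 rs by (intro real_sqrt_le_mono frac_le mult_left_mono) auto
      also have "2 * pi * 16 / (real s / 2) = 8\<^sup>2 * pi / real s" by simp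
      also have "sqrt (8\<^sup>2 * pi / real s) = 8 * sqrt pi / sqrt (real s)"
        by (simp only: real_sqrt_divide real_sqrt_mult real_sqrt_abs abs_numeral)
      finally show "sqrt (2 * pi * M) / sqrt n \<le> 8 * sqrt pi / sqrt (real s)" .
    qed
    finally have E_le: "\<bar>E\<bar> \<le> 8 * sqrt pi * K / sqrt (real s)" by (simp add: mult_ac)
    have "real (ba_count (r - 1) s) = fact s * fact r * X * (inverse (x ^ r) * inverse (y ^ s))"
      using pos by (simp add: X_def field_simps)
    also have "X = (exp (- y) + E) * G" using Gpos by (simp add: E_def)
    finally have "real (ba_count (r - 1) s) =
          fact s * fact r * (exp (- y) + E) * (1 / sqrt (2 * pi)) *
          x powi (- int r) * y powi (- int s) *
          sqrt (y * exp (- y) / (real s * Qxy x y))"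
      by (simp add: G_def power_int_minus mult_ac)
    with E_le show ?thesis by blast
  qed
  show ?thesis
    by (intro exI[of _ "8 * sqrt pi * K"] exI[of _ "16 :: nat"] allI impI)
       (unfold Let_def, rule main, auto)
qed

end
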